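(* Let $G$ be a topological group. If there exists a functorial embedding of the closed interval $[0,1]$ into $G$, then $G$ contains a subspace homeomorphic to the sequential hedgehog $IS_\omega$.
   Context: Functorial embedding: a functorial embedding of a topological space $X$ into a topological group $G$ is a topological embedding $i:X\to G$ together with an assignment to each autohomeomorphism $h:X\to X$ of a continuous group homomorphism $Fh:G\to G$ such that $Fh\circ i=i\circ h$ (that is, $Fh$ extends $h$ when $X$ is identified with $i(X)$), $F(\mathrm{id}_X)=\mathrm{id}_G$ and $F(g\circ h)=Fg\circ Fh$ for all autohomeomorphisms $g,h$ of $X$. Sequential hedgehog: $IS_\omega$ is the quotient space $([0,1]\times\omega)/(\{0\}\times\omega)$, obtained from $[0,1]\times\omega$ ($\omega$ discrete) by collapsing $\{0\}\times\omega$ to a point, with the quotient topology. *)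

theory Defs
  imports "HOL-Analysis.Analysis"
begin

(* Autohomeomorphisms are extensional functions, so that two of them are equal as soon as they
   agree on the space; identity and composition are accordingly the restricted ones. *)
definition autohomeomorphisms :: "'x topology \<Rightarrow> ('x \<Rightarrow> 'x) set" where
  "autohomeomorphisms X = {h \<in> extensional (topspace X). homeomorphic_map X X h}"

(* The class topological_group_add does not assume commutativity or any separation axiom:
   its types are arbitrary topological groups, written additively. *)
definition functorial_embedding ::
    "'x topology \<Rightarrow> ('x \<Rightarrow> 'g::topological_group_add) \<Rightarrow> (('x \<Rightarrow> 'x) \<Rightarrow> 'g \<Rightarrow> 'g) \<Rightarrow> bool" where
  "functorial_embedding X i F \<longleftrightarrow>
     embedding_map X euclidean i \<and>
     (\<forall>h \<in> autohomeomorphisms X.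
        continuous_on UNIV (F h) \<and>
        (\<forall>a b. F h (a + b) = F h a + F h b) \<and>
        (\<forall>x \<in> topspace X. F h (i x) = i (h x))) \<and>
     F (\<lambda>x \<in> topspace X. x) = id \<and>
     (\<forall>g \<in> autohomeomorphisms X. \<forall>h \<in> autohomeomorphisms X.
        F (compose (topspace X) g h) = F g \<circ> F h)"

definition quotient_topology :: "'a topology \<Rightarrow> ('a \<times> 'a) set \<Rightarrow> 'a set topology" where
  "quotient_topology X R =
     topology (\<lambda>U. U \<subseteq> topspace X // R \<and> openin X {x \<in> topspace X. R `` {x} \<in> U})"

lemma openin_quotient_topology:
  "openin (quotient_topology X R) U \<longleftrightarrow>
     U \<subseteq> topspace X // R \<and> openin X {x \<in> topspace X. R `` {x} \<in> U}"
proof -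
  have "istopology (\<lambda>U. U \<subseteq> topspace X // R \<and> openin X {x \<in> topspace X. R `` {x} \<in> U})"
    unfolding istopology_def
  proof (intro conjI allI impI)
    fix S T
    assume "S \<subseteq> topspace X // R \<and> openin X {x \<in> topspace X. R `` {x} \<in> S}"
      and "T \<subseteq> topspace X // R \<and> openin X {x \<in> topspace X. R `` {x} \<in> T}"
    moreover have "{x \<in> topspace X. R `` {x} \<in> S \<inter> T} =
        {x \<in> topspace X. R `` {x} \<in> S} \<inter> {x \<in> topspace X. R `` {x} \<in> T}"
      by blast
    ultimately show "S \<inter> T \<subseteq> topspace X // R"
      "openin X {x \<in> topspace X. R `` {x} \<in> S \<inter> T}"
      by auto
  next
    fix \<U>
    assume *: "\<forall>U\<in>\<U>. U \<subseteq> topspace X // R \<and> openin X {x \<in> topspace X. R `` {x} \<in> U}"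
    have "{x \<in> topspace X. R `` {x} \<in> \<Union>\<U>} = (\<Union>U\<in>\<U>. {x \<in> topspace X. R `` {x} \<in> U})"
      by blast
    with * show "\<Union>\<U> \<subseteq> topspace X // R"
      "openin X {x \<in> topspace X. R `` {x} \<in> \<Union>\<U>}"
      by auto
  qed
  then show ?thesis
    by (simp add: quotient_topology_def topology_inverse')
qed

lemma topspace_quotient_topology [simp]: "topspace (quotient_topology X R) = topspace X // R"
proof -
  have "{x \<in> topspace X. R `` {x} \<in> topspace X // R} = topspace X"
    by (auto simp: quotient_def)
  then have "openin (quotient_topology X R) (topspace X // R)"
    by (simp add: openin_quotient_topology)
  then show ?thesis
    by (metis openin_quotient_topology openin_subset openin_topspace subset_antisym)
qed

lemma quotient_map_quotient_topology:
  "quotient_map X (quotient_topology X R) (\<lambda>x. R `` {x})"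
  by (auto simp: quotient_map_def openin_quotient_topology quotient_def)

definition hedgehog_base :: "(real \<times> nat) topology" where
  "hedgehog_base = prod_topology (top_of_set {0..1}) (discrete_topology UNIV)"

definition hedgehog_rel :: "((real \<times> nat) \<times> (real \<times> nat)) set" where
  "hedgehog_rel = {(p, q). p \<in> topspace hedgehog_base \<and> q \<in> topspace hedgehog_base \<and>
                     (p = q \<or> fst p = 0 \<and> fst q = 0)}"

lemma equiv_hedgehog_rel: "equiv (topspace hedgehog_base) hedgehog_rel"
  by (auto simp: equiv_def refl_on_def sym_def trans_def hedgehog_rel_def)

definition sequential_hedgehog :: "(real \<times> nat) set topology" where
  "sequential_hedgehog = quotient_topology hedgehog_base hedgehog_rel"

end

theory Submission
  imports Defs
begin

text \<open>Rescale the arc to \<open>[0, 2]\<close>. A hedgehog is found from spines \<open>\<gamma>\<^sub>n\<close> starting at \<open>0\<close> such that for every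
  choice of \<open>\<epsilon>\<^sub>n > 0\<close> some homeomorphism \<open>h\<close> satisfies \<open>F h (\<gamma>\<^sub>n t) \<notin> U\<close> for all \<open>n\<close> and \<open>t \<ge> \<epsilon>\<^sub>n\<close>, with
  \<open>U\<close> a fixed neighbourhood of \<open>0\<close>: then \<open>(F h)\<inverse>(U)\<close> meets the \<open>n\<close>-th spine only in parameters below \<open>\<epsilon>\<^sub>n\<close>.
  The spines are sums of differences \<open>- i x + i y\<close>.

  If arbitrarily close to some \<open>p\<close>, on its right, there are such sums outside \<open>U\<close>, choose them in
  disjoint intervals converging to \<open>p\<close> and let \<open>\<gamma>\<^sub>n\<close> open up the pairs of the \<open>n\<close>-th sum; \<open>h\<close> only has to
  accelerate the opening.

  Otherwise all sums close to the right of a point are small. Let \<open>\<gamma>\<^sub>n t\<close> be the sum over the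
  \<open>t\<close>-neighbourhood of the set of dyadic points of \<open>[0, 1]\<close> with at most \<open>n\<close> binary ones, a set of finite
  Cantor-Bendixson rank; hence \<open>\<gamma>\<^sub>n\<close> tends to \<open>0\<close>. Given \<open>\<epsilon>\<close>, choose \<open>\<phi>\<close> with \<open>2\<close> to the power \<open>- \<phi> n\<close> below
  \<open>\<epsilon>\<^sub>n\<close>, and let \<open>h\<close> be the distribution function of a measure for which more than \<open>n\<close> ones among the
  first \<open>\<phi> n\<close> digits are extremely unlikely. The gaps of the image sum are then so short that it is
  close to \<open>- i 0 + i 1\<close>, which is not near \<open>0\<close>.\<close>

section \<open>Neighbourhoods in topological groups\<close>

lemma open_add_split:
  fixes x y :: "'g::topological_group_add"
  assumes "open U" "x + y \<in> U"
  shows "\<exists>A B. open A \<and> open B \<and> x \<in> A \<and> y \<in> B \<and> (\<forall>u\<in>A. \<forall>v\<in>B. u + v \<in> U)"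
proof -
  have "((\<lambda>p. fst p + snd p) \<longlongrightarrow> x + y) (nhds (x, y))"
    using tendsto_add[OF tendsto_fst[OF filterlim_ident] tendsto_snd[OF filterlim_ident], of "(x, y)"]
    by simp
  then have "eventually (\<lambda>p. fst p + snd p \<in> U) (nhds (x, y))"
    using assms by (auto dest: topological_tendstoD)
  then obtain A where A: "open A" "(x, y) \<in> A" "\<And>p. p \<in> A \<Longrightarrow> fst p + snd p \<in> U"
    by (auto simp: eventually_nhds)
  obtain B C where BC: "open B" "open C" "(x, y) \<in> B \<times> C" "B \<times> C \<subseteq> A"
    using open_prod_elim[OF A(1,2)] by blast
  have "u + v \<in> U" if "u \<in> B" "v \<in> C" for u v
  proof -
    have "(u, v) \<in> A" using that BC by blast
    with A(3)[of "(u, v)"] show ?thesis by simp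
  qed
  with BC show ?thesis by (intro exI[of _ B] exI[of _ C]) simp
qed

lemma nhds_zero_half:
  fixes U :: "'g::topological_group_add set"
  assumes "open U" "0 \<in> U"
  shows "\<exists>V. open V \<and> 0 \<in> V \<and> (\<forall>x\<in>V. -x \<in> V) \<and> (\<forall>x\<in>V. \<forall>y\<in>V. x + y \<in> U)"
proof -
  have zero: "0 + 0 \<in> U" using assms by simp
  obtain A B where AB: "open A" "open B" "0 \<in> A" "0 \<in> B" "\<forall>u\<in>A. \<forall>v\<in>B. u + v \<in> U"
    using open_add_split[OF assms(1) zero] by blast
  define D where "D = A \<inter> B"
  have D: "open D" "0 \<in> D" "\<And>x y. x \<in> D \<Longrightarrow> y \<in> D \<Longrightarrow> x + y \<in> U"
    using AB by (auto simp: D_def)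
  have "open (uminus -` D)"
    by (intro open_vimage D continuous_intros)
  with D show ?thesis
    by (intro exI[of _ "D \<inter> uminus -` D"]) auto
qed

lemma open_left_translation:
  fixes N :: "'g::topological_group_add set"
  assumes "open N"
  shows "open {x. a + x \<in> N}" "open {x. a - x \<in> N}"
proof -
  have "open ((\<lambda>x. a + x) -` N)" "open ((\<lambda>x. a - x) -` N)"
    by (intro open_vimage assms continuous_intros)+
  then show "open {x. a + x \<in> N}" "open {x. a - x \<in> N}"
    by (simp_all add: vimage_def)
qed

text \<open>The group need not be a \<open>T\<^sub>0\<close> space, so topological distinguishability replaces inequality.\<close>

definition insep :: "'g::topological_group_add \<Rightarrow> 'g \<Rightarrow> bool" where
  "insep x y \<longleftrightarrow> (\<forall>N. open N \<and> 0 \<in> N \<longrightarrow> -x + y \<in> N)"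

lemma insep_sym: assumes "insep x y" shows "insep y x"
  unfolding insep_def
proof (intro allI impI, elim conjE)
  fix N :: "'a set" assume N: "open N" "0 \<in> N"
  have "open (uminus -` N)" by (intro open_vimage N continuous_intros)
  then have "-x + y \<in> uminus -` N"
    using assms N by (auto simp: insep_def)
  then show "-y + x \<in> N" by (simp add: minus_add)
qed

lemma insep_trans: assumes "insep x y" "insep y z" shows "insep x z"
  unfolding insep_def
proof (intro allI impI, elim conjE)
  fix N :: "'a set" assume N: "open N" "0 \<in> N"
  obtain V where V: "open V" "0 \<in> V" "\<And>x. x \<in> V \<Longrightarrow> -x \<in> V"
    "\<And>x y. x \<in> V \<Longrightarrow> y \<in> V \<Longrightarrow> x + y \<in> N"
    using nhds_zero_half[OF N(1,2)] by blast
  have "-x + y \<in> V" "-y + z \<in> V"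
    using assms V by (auto simp: insep_def)
  then have "(-x + y) + (-y + z) \<in> N" by (rule V)
  then show "-x + z \<in> N" by (simp add: add.assoc)
qed

text \<open>With \<open>V\<close> symmetric and \<open>V + V\<close> inside \<open>N\<close>, a
  common point of \<open>x + V\<close> and \<open>y + V\<close> would put \<open>-x + y\<close> into
  \<open>N\<close>.\<close>

lemma not_insep_disjoint_nhds:
  assumes "\<not> insep x y"
  obtains A B where "open A" "open B" "x \<in> A" "y \<in> B" "A \<inter> B = {}"
proof -
  obtain N where N: "open N" "0 \<in> N" "-x + y \<notin> N"
    using assms by (auto simp: insep_def)
  obtain V where V: "open V" "0 \<in> V" "\<And>x. x \<in> V \<Longrightarrow> -x \<in> V"
    "\<And>x y. x \<in> V \<Longrightarrow> y \<in> V \<Longrightarrow> x + y \<in> N"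
    using nhds_zero_half[OF N(1,2)] by blast
  let ?A = "{z. -x + z \<in> V}" and ?B = "{z. -y + z \<in> V}"
  have "?A \<inter> ?B = {}"
  proof (intro equals0I)
    fix z assume "z \<in> ?A \<inter> ?B"
    then have "(-x + z) + -(-y + z) \<in> N"
      by (intro V(3,4)) auto
    then show False
      using N(3) by (simp add: minus_add add.assoc)
  qed
  with V show thesis
    by (intro that[of ?A ?B]) (auto intro: open_left_translation)
qed

text \<open>Replaces the closedness of compact sets, which may fail in a group that is not
  Hausdorff: disjoint neighbourhoods are supplied pair by pair and a finite subcover does the
  rest.\<close>

lemma compact_separation:
  assumes "compact K" "\<And>z. z \<in> K \<Longrightarrow> \<not> insep y z"
  obtains B where "open B" "y \<in> B" "B \<inter> K = {}"
proof -
  have "\<forall>z\<in>K. \<exists>A B. open A \<and> open B \<and> y \<in> A \<and> z \<in> B \<and> A \<inter> B = {}"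
    using assms(2) by (meson not_insep_disjoint_nhds)
  then obtain A B where AB: "\<And>z. z \<in> K \<Longrightarrow> open (A z)" "\<And>z. z \<in> K \<Longrightarrow> open (B z)"
    "\<And>z. z \<in> K \<Longrightarrow> y \<in> A z" "\<And>z. z \<in> K \<Longrightarrow> z \<in> B z" "\<And>z. z \<in> K \<Longrightarrow> A z \<inter> B z = {}"
    by metis
  obtain C where C: "C \<subseteq> K" "finite C" "K \<subseteq> (\<Union>z\<in>C. B z)"
    by (rule compactE_image[OF assms(1), of K B]) (use AB in auto)
  show thesis
  proof (rule that[of "\<Inter>z\<in>C. A z"])
    show "open (\<Inter>z\<in>C. A z)" using C AB by (intro open_INT) auto
    show "y \<in> (\<Inter>z\<in>C. A z)" using C AB by auto
    show "(\<Inter>z\<in>C. A z) \<inter> K = {}"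
    proof (intro equals0I)
      fix x assume "x \<in> (\<Inter>z\<in>C. A z) \<inter> K"
      then obtain z where "z \<in> C" "x \<in> A z" "x \<in> B z" using C(3) by blast
      then show False using AB(5)[of z] C(1) by auto
    qed
  qed
qed

section \<open>Recognizing a hedgehog in a group\<close>

lemma topspace_hedgehog_base: "topspace hedgehog_base = {0..1} \<times> UNIV"
  by (simp add: hedgehog_base_def)

lemma openin_hedgehog_base:
  "openin hedgehog_base W \<longleftrightarrow>
     W \<subseteq> {0..1} \<times> UNIV \<and> (\<forall>n. openin (top_of_set {0..1}) {t. (t, n) \<in> W})"
proof
  assume W: "openin hedgehog_base W"
  then have "W \<subseteq> {0..1} \<times> UNIV"
    by (metis openin_subset topspace_hedgehog_base)
  moreover have "openin (top_of_set {0..1}) {t. (t, n) \<in> W}" for n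
  proof -
    have "continuous_map (top_of_set {0..1}) hedgehog_base (\<lambda>t. (t, n))"
      unfolding hedgehog_base_def by (intro continuous_intros) auto
    from openin_continuous_map_preimage[OF this W]
    have "openin (top_of_set {0..1}) {x \<in> {0..1}. (x, n) \<in> W}" by simp
    also have "{x \<in> {0..1}. (x, n) \<in> W} = {t. (t, n) \<in> W}"
      using \<open>W \<subseteq> _\<close> by auto
    finally show ?thesis .
  qed
  ultimately show "W \<subseteq> {0..1} \<times> UNIV \<and> (\<forall>n. openin (top_of_set {0..1}) {t. (t, n) \<in> W})"
    by blast
next
  assume W: "W \<subseteq> {0..1} \<times> UNIV \<and> (\<forall>n. openin (top_of_set {0..1}) {t. (t, n) \<in> W})"
  have "W = (\<Union>n. {t. (t, n) \<in> W} \<times> {n})" by auto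
  moreover have "openin hedgehog_base ({t. (t, n) \<in> W} \<times> {n})" for n
    unfolding hedgehog_base_def by (subst openin_prod_Times_iff) (use W in auto)
  ultimately show "openin hedgehog_base W"
    by (metis (no_types, lifting) openin_Union rangeE)
qed

text \<open>Quotient maps with the same fibres have homeomorphic targets: \<open>f\<close> factors
  through the canonical projection, and the factor \<open>g\<close> is again a quotient map and
  injective.\<close>

lemma hedgehog_quotient_homeomorphic:
  assumes q: "quotient_map hedgehog_base Y f"
    and f: "\<And>p q. p \<in> topspace hedgehog_base \<Longrightarrow> q \<in> topspace hedgehog_base \<Longrightarrow>
              f p = f q \<longleftrightarrow> (p, q) \<in> hedgehog_rel"
  shows "Y homeomorphic_space sequential_hedgehog"
proof -
  let ?X = hedgehog_base and ?\<pi> = "\<lambda>x. hedgehog_rel `` {x}"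
  have p: "quotient_map ?X sequential_hedgehog ?\<pi>"
    unfolding sequential_hedgehog_def by (rule quotient_map_quotient_topology)
  have pi: "?\<pi> x = ?\<pi> y \<longleftrightarrow> f x = f y" if "x \<in> topspace ?X" "y \<in> topspace ?X" for x y
    using eq_equiv_class_iff[OF equiv_hedgehog_rel that] f[OF that] by simp
  obtain g where g: "continuous_map sequential_hedgehog Y g"
    "g ` topspace sequential_hedgehog = f ` topspace ?X" "\<And>x. x \<in> topspace ?X \<Longrightarrow> g (?\<pi> x) = f x"
    using quotient_map_lift_exists[OF p quotient_imp_continuous_map[OF q]] pi by metis
  have "quotient_map ?X Y (g \<circ> ?\<pi>)"
    using q by (rule quotient_map_eq) (simp add: g)
  then have "quotient_map sequential_hedgehog Y g"
    by (rule quotient_map_from_composition[OF quotient_imp_continuous_map[OF p] g(1)])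
  moreover have "inj_on g (topspace sequential_hedgehog)"
  proof (rule inj_onI)
    fix c d assume "c \<in> topspace sequential_hedgehog" "d \<in> topspace sequential_hedgehog" and eq: "g c = g d"
    then obtain x y where xy: "x \<in> topspace ?X" "y \<in> topspace ?X" "c = ?\<pi> x" "d = ?\<pi> y"
      using quotient_imp_surjective_map[OF p] by (metis (no_types, lifting) imageE)
    with eq g(3) have "f x = f y" by simp
    with pi xy show "c = d" by simp
  qed
  ultimately have "homeomorphic_map sequential_hedgehog Y g"
    by (simp add: homeomorphic_map_def)
  then show ?thesis
    using homeomorphic_map_imp_homeomorphic_space homeomorphic_space_sym by blast
qed

text \<open>Prepares the topology away from the apex. By \<open>fan\<close> with a constant, all
  points of parameter at least \<open>1 / real (Suc m)\<close> avoid one neighbourhood of 0.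
  Shortening spine \<open>n\<close> to \<open>[0, \<tau> n]\<close> puts it into \<open>W 0\<close>,
  ..., \<open>W n\<close>, so that near a point other than the apex only finitely many shortened
  spines remain.\<close>

lemma spines_refine:
  fixes \<gamma> :: "nat \<Rightarrow> real \<Rightarrow> 'g::topological_group_add"
  assumes cont: "\<And>n. continuous_on {0..1} (\<gamma> n)"
    and zero: "\<And>n. \<gamma> n 0 = 0"
    and fan: "\<And>\<epsilon>. (\<And>n. \<epsilon> n > 0) \<Longrightarrow>
        \<exists>V. open V \<and> 0 \<in> V \<and> (\<forall>n t. \<epsilon> n \<le> t \<and> t \<le> 1 \<longrightarrow> \<gamma> n t \<notin> V)"
  shows "\<exists>W \<tau>. (\<forall>m. open (W m) \<and> 0 \<in> W m \<and>
             (\<forall>n s. 1 / real (Suc m) \<le> s \<and> s \<le> 1 \<longrightarrow> (\<forall>y \<in> W m. \<gamma> n s - y \<notin> W m))) \<and>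
           (\<forall>n. 0 < \<tau> n \<and> \<tau> n \<le> (1::real) \<and> (\<forall>m\<le>n. \<forall>t. 0 \<le> t \<and> t \<le> \<tau> n \<longrightarrow> \<gamma> n t \<in> W m))"
proof -
  have "\<exists>W. open W \<and> 0 \<in> W \<and> (\<forall>n s. 1 / real (Suc m) \<le> s \<and> s \<le> 1 \<longrightarrow> (\<forall>y \<in> W. \<gamma> n s - y \<notin> W))" for m
  proof -
    obtain V where V: "open V" "0 \<in> V" "\<forall>n t. 1 / real (Suc m) \<le> t \<and> t \<le> 1 \<longrightarrow> \<gamma> n t \<notin> V"
      using fan[of "\<lambda>_. 1 / real (Suc m)"] by auto
    obtain W where W: "open W" "0 \<in> W" "\<forall>x\<in>W. \<forall>y\<in>W. x + y \<in> V"
      using nhds_zero_half[OF V(1,2)] by blast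
    have "\<gamma> n s - y \<notin> W" if "1 / real (Suc m) \<le> s" "s \<le> 1" "y \<in> W" for n s y
    proof
      assume "\<gamma> n s - y \<in> W"
      with W(3) that have "(\<gamma> n s - y) + y \<in> V" by blast
      with V(3) that show False by simp
    qed
    with W show ?thesis by (intro exI[of _ W]) simp
  qed
  then obtain W where W: "\<And>m. open (W m)" "\<And>m. 0 \<in> W m"
    "\<And>m n s y. 1 / real (Suc m) \<le> s \<Longrightarrow> s \<le> 1 \<Longrightarrow> y \<in> W m \<Longrightarrow> \<gamma> n s - y \<notin> W m"
    by metis
  \<comment> \<open>Restricting to \<open>m \<le> n\<close> keeps the intersection finite, hence
    open.\<close>
  have "\<exists>\<tau>>0. \<tau> \<le> 1 \<and> (\<forall>m\<le>n. \<forall>t. 0 \<le> t \<and> t \<le> \<tau> \<longrightarrow> \<gamma> n t \<in> W m)" for n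
  proof -
    have "open (\<Inter>m\<in>{..n}. W m)" using W by (intro open_INT) auto
    moreover have "\<gamma> n 0 \<in> (\<Inter>m\<in>{..n}. W m)" using W zero by simp
    moreover have "(\<gamma> n \<longlongrightarrow> \<gamma> n 0) (at 0 within {0..1})"
      using cont[of n] by (simp add: continuous_on_def)
    ultimately have "eventually (\<lambda>t. \<gamma> n t \<in> (\<Inter>m\<in>{..n}. W m)) (at 0 within {0..1})"
      by (metis topological_tendstoD)
    then obtain d where d: "d > 0" "\<forall>t\<in>{0..1}. t \<noteq> 0 \<and> dist t 0 < d \<longrightarrow> \<gamma> n t \<in> (\<Inter>m\<in>{..n}. W m)"
      by (auto simp: eventually_at)
    have "\<gamma> n t \<in> W m" if "m \<le> n" "0 \<le> t" "t \<le> min (d/2) 1" for m t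
    proof (cases "t = 0")
      case True then show ?thesis using W zero by simp
    next
      case False
      then have "\<gamma> n t \<in> (\<Inter>m\<in>{..n}. W m)" using d that by (auto simp: dist_real_def)
      then show ?thesis using that by blast
    qed
    then show ?thesis using d(1) by (intro exI[of _ "min (d/2) 1"]) simp
  qed
  then obtain \<tau> where "\<And>n. 0 < \<tau> n \<and> \<tau> n \<le> 1 \<and> (\<forall>m\<le>n. \<forall>t. 0 \<le> t \<and> t \<le> \<tau> n \<longrightarrow> \<gamma> n t \<in> W m)"
    by metis
  with W show ?thesis
    by (intro exI[of _ W] exI[of _ \<tau>]) auto
qed

text \<open>The shortened spines form a hedgehog: the point is that their subspace topology is as
  fine as the quotient topology. At the apex this is \<open>fan\<close>; elsewhere all but finitely
  many spines are cut off by \<open>W\<close> and the others by compactness.\<close>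

lemma hedgehog_of_spines:
  fixes \<gamma> :: "nat \<Rightarrow> real \<Rightarrow> 'g::topological_group_add"
  assumes cont: "\<And>n. continuous_on {0..1} (\<gamma> n)"
    and zero: "\<And>n. \<gamma> n 0 = 0"
    and sep: "\<And>n m s t. s \<in> {0<..1} \<Longrightarrow> t \<in> {0..1} \<Longrightarrow> (n, s) \<noteq> (m, t) \<Longrightarrow> \<not> insep (\<gamma> n s) (\<gamma> m t)"
    and fan: "\<And>\<epsilon>. (\<And>n. \<epsilon> n > 0) \<Longrightarrow>
        \<exists>V. open V \<and> 0 \<in> V \<and> (\<forall>n t. \<epsilon> n \<le> t \<and> t \<le> 1 \<longrightarrow> \<gamma> n t \<notin> V)"
  shows "\<exists>S :: 'g set. top_of_set S homeomorphic_space sequential_hedgehog"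
proof -
  obtain W \<tau> where W: "\<And>m. open (W m)" "\<And>m. 0 \<in> W m"
      "\<And>m n s y. 1 / real (Suc m) \<le> s \<Longrightarrow> s \<le> 1 \<Longrightarrow> y \<in> W m \<Longrightarrow> \<gamma> n s - y \<notin> W m"
    and \<tau>: "\<And>n. 0 < \<tau> n" "\<And>n. \<tau> n \<le> (1::real)"
      "\<And>m n t. m \<le> n \<Longrightarrow> 0 \<le> t \<Longrightarrow> t \<le> \<tau> n \<Longrightarrow> \<gamma> n t \<in> W m"
    using spines_refine[of \<gamma>, OF cont zero fan] by metis
  \<comment> \<open>Spine \<open>n\<close> is used only on \<open>[0, \<tau> n]\<close>,
    reparametrised by \<open>[0, 1]\<close>.\<close>
  define f where "f = (\<lambda>p. \<gamma> (snd p) (\<tau> (snd p) * fst p))"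
  define S where "S = f ` ({0..1} \<times> UNIV)"
  have \<tau>01: "\<tau> n * t \<in> {0..1}" if "t \<in> {0..1}" for n t
    using that \<tau>(1,2)[of n] mult_mono[of "\<tau> n" 1 t 1] by auto
  have fcont: "continuous_on {0..1} (\<lambda>t. f (t, n))" for n
    unfolding f_def fst_conv snd_conv
    by (intro continuous_on_compose2[OF cont[of n]] continuous_intros) (use \<tau>01 in auto)
  have f0: "f (0, n) = 0" for n by (simp add: f_def zero)
  have fsep: "\<not> insep (f (s, n)) (f (t, m))"
    if "s \<in> {0<..1}" "t \<in> {0..1}" "(s, n) \<noteq> (t, m)" for s t n m
    unfolding f_def fst_conv snd_conv
  proof (rule sep)
    show "\<tau> n * s \<in> {0<..1}" using that \<tau>01[of s n] \<tau>(1)[of n] by auto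
    show "\<tau> m * t \<in> {0..1}" using that \<tau>01 by blast
    show "(n, \<tau> n * s) \<noteq> (m, \<tau> m * t)" using that \<tau>(1)[of n] by auto
  qed
  have insep_refl: "insep x x" for x :: 'g by (simp add: insep_def)
  have main: "openin (top_of_set S) U"
    if "U \<subseteq> S" and U: "openin hedgehog_base {x \<in> topspace hedgehog_base. f x \<in> U}" for U
  proof -
    have Un: "openin (top_of_set {0..1}) {t \<in> {0..1}. f (t, n) \<in> U}" for n
      using U by (simp add: openin_hedgehog_base topspace_hedgehog_base)
    have "\<exists>T. open T \<and> y \<in> T \<and> T \<inter> S \<subseteq> U" if yU: "y \<in> U" for y
    proof (cases "y = 0")
      case True
      have "\<exists>e>0. \<forall>t\<in>{0..1}. t < e \<longrightarrow> f (t, n) \<in> U" for n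
      proof -
        have "0 \<in> {t \<in> {0..1}. f (t, n) \<in> U}" using yU True f0 by simp
        then obtain e where "e > 0" "\<forall>t\<in>{0..1}. dist t 0 < e \<longrightarrow> t \<in> {t \<in> {0..1}. f (t, n) \<in> U}"
          using Un[of n] unfolding openin_euclidean_subtopology_iff by blast
        then show ?thesis by (intro exI[of _ e]) (auto simp: dist_real_def)
      qed
      then obtain e where e: "\<And>n. e n > 0" "\<And>n t. t \<in> {0..1} \<Longrightarrow> t < e n \<Longrightarrow> f (t, n) \<in> U"
        by metis
      \<comment> \<open>The original parameter of \<open>f (t, n)\<close> is
        \<open>\<tau> n * t\<close>, so the threshold \<open>e n\<close> becomes
        \<open>\<tau> n * e n\<close>.\<close>
      obtain V where V: "open V" "0 \<in> V" "\<forall>n t. \<tau> n * e n \<le> t \<and> t \<le> 1 \<longrightarrow> \<gamma> n t \<notin> V"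
        using fan[of "\<lambda>n. \<tau> n * e n"] e(1) \<tau>(1) by auto
      have "V \<inter> S \<subseteq> U"
      proof
        fix x assume "x \<in> V \<inter> S"
        then obtain t n where x: "x = f (t, n)" "t \<in> {0..1}" "x \<in> V"
          by (auto simp: S_def)
        have "t < e n"
        proof (rule ccontr)
          assume "\<not> t < e n"
          then have "\<tau> n * e n \<le> \<tau> n * t" using \<tau>(1)[of n] by simp
          then show False using V(3) x \<tau>01[of t n] by (auto simp: f_def)
        qed
        with e x show "x \<in> U" by blast
      qed
      with V True show ?thesis by blast
    next
      case False
      obtain t0 n0 where y: "y = f (t0, n0)" "t0 \<in> {0..1}"
        using yU \<open>U \<subseteq> S\<close> unfolding S_def by fast
      with False f0 have t0: "t0 \<in> {0<..1}" by (cases "t0 = 0") auto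
      \<comment> \<open>The original parameter of \<open>y\<close> exceeds
        \<open>1 / real (Suc m)\<close>, so only the spines below \<open>m\<close> can approach
        \<open>y\<close>.\<close>
      obtain m where m: "inverse (real (Suc m)) < \<tau> n0 * t0"
        using reals_Archimedean[of "\<tau> n0 * t0"] t0 \<tau>(1)[of n0] by auto
      have "\<exists>B. open B \<and> y \<in> B \<and> (\<forall>t\<in>{0..1}. f (t, k) \<in> B \<longrightarrow> f (t, k) \<in> U)" for k
      proof -
        \<comment> \<open>The part of spine \<open>k\<close> outside \<open>U\<close> is compact,
          and none of its points is inseparable from \<open>y\<close>.\<close>
        let ?C = "{0..1} - {t \<in> {0..1}. f (t, k) \<in> U}"
        have "closedin (top_of_set {0..1}) ?C"
          using Un[of k] by (simp add: closedin_diff)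
        then have "compact ?C"
          using closedin_compact compact_Icc by blast
        then have "compact ((\<lambda>t. f (t, k)) ` ?C)"
          by (rule compact_continuous_image[OF continuous_on_subset[OF fcont[of k]], rotated]) auto
        moreover have "\<not> insep y z" if "z \<in> (\<lambda>t. f (t, k)) ` ?C" for z
        proof -
          from that obtain t where t: "t \<in> ?C" "z = f (t, k)" by blast
          then have "t \<in> {0..1}" "z \<notin> U" by auto
          then show ?thesis unfolding y(1) t(2)
            by (intro fsep t0) (use y yU t in auto)
        qed
        ultimately obtain B where "open B" "y \<in> B" "B \<inter> ((\<lambda>t. f (t, k)) ` ?C) = {}"
          by (rule compact_separation)
        then show ?thesis by (intro exI[of _ B]) auto
      qed
      then obtain B where B: "\<And>k. open (B k)" "\<And>k. y \<in> B k"
        "\<And>k t. t \<in> {0..1} \<Longrightarrow> f (t, k) \<in> B k \<Longrightarrow> f (t, k) \<in> U" by metis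
      \<comment> \<open>The first factor excludes all spines \<open>n \<ge> m\<close>, which lie in
        \<open>W m\<close>; the second treats the spines below \<open>m\<close> one by one.\<close>
      let ?T = "{z. y - z \<in> W m} \<inter> (\<Inter>k\<in>{..<m}. B k)"
      have "open ?T"
        by (intro open_Int open_INT open_left_translation W) (use B in auto)
      moreover have "y \<in> ?T" using W(2) B(2) by simp
      moreover have "?T \<inter> S \<subseteq> U"
      proof
        fix x assume "x \<in> ?T \<inter> S"
        then obtain t n where x: "x = f (t, n)" "t \<in> {0..1}" "x \<in> ?T"
          by (auto simp: S_def)
        have "n < m"
        proof (rule ccontr)
          assume "\<not> n < m"
          then have "x \<in> W m"
            unfolding x f_def fst_conv snd_conv
            using x(2) \<tau>(1)[of n] by (intro \<tau>(3)) (auto simp: mult_left_le)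
          moreover have "1 / real (Suc m) \<le> \<tau> n0 * t0" using m by (simp add: inverse_eq_divide)
          ultimately have "y - x \<notin> W m"
            unfolding y f_def fst_conv snd_conv using \<tau>01[OF y(2), of n0]
            by (intro W(3)) auto
          with x show False by simp
        qed
        with x B(3) show "x \<in> U" by auto
      qed
      ultimately show ?thesis by blast
    qed
    then have "\<forall>y\<in>U. \<exists>V. openin (top_of_set S) V \<and> y \<in> V \<and> V \<subseteq> U"
      using \<open>U \<subseteq> S\<close> by (metis IntI inf_commute openin_open_Int subsetD)
    then show ?thesis by (subst openin_subopen) blast
  qed
  have "quotient_map hedgehog_base (top_of_set S) f"
    unfolding quotient_map_def
  proof (intro conjI allI impI)
    show "f ` topspace hedgehog_base = topspace (top_of_set S)"
      by (simp add: topspace_hedgehog_base S_def)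
    fix U assume "U \<subseteq> topspace (top_of_set S)"
    then have US: "U \<subseteq> S" by simp
    show "openin hedgehog_base {x \<in> topspace hedgehog_base. f x \<in> U} = openin (top_of_set S) U"
    proof
      assume "openin (top_of_set S) U"
      then obtain T where T: "open T" "U = S \<inter> T" by (auto simp: openin_open)
      have "openin (top_of_set {0..1}) {t \<in> {0..1}. f (t, n) \<in> U}" for n
      proof -
        have "{t \<in> {0..1}. f (t, n) \<in> U} = {0..1} \<inter> (\<lambda>t. f (t, n)) -` T"
          using T by (auto simp: S_def)
        then show ?thesis
          using continuous_openin_preimage_gen[OF fcont[of n] T(1)] by simp
      qed
      then show "openin hedgehog_base {x \<in> topspace hedgehog_base. f x \<in> U}"
        by (auto simp: openin_hedgehog_base topspace_hedgehog_base)
    qed (rule main[OF US])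
  qed
  then show ?thesis
  proof (intro exI[of _ S] hedgehog_quotient_homeomorphic)
    fix p q assume pq: "p \<in> topspace hedgehog_base" "q \<in> topspace hedgehog_base"
    obtain s n t m where [simp]: "p = (s, n)" "q = (t, m)" by (cases p, cases q)
    have st: "s \<in> {0..1}" "t \<in> {0..1}" using pq by (auto simp: topspace_hedgehog_base)
    have "f p = f q \<longleftrightarrow> p = q \<or> (s = 0 \<and> t = 0)"
    proof
      assume eq: "f p = f q"
      show "p = q \<or> (s = 0 \<and> t = 0)"
      proof (rule ccontr)
        assume "\<not> (p = q \<or> (s = 0 \<and> t = 0))"
        then have ne: "(s, n) \<noteq> (t, m)" "s \<noteq> 0 \<or> t \<noteq> 0" by auto
        then consider "s \<in> {0<..1}" | "t \<in> {0<..1}" using st by fastforce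
        then show False
        proof cases
          case 1 from fsep[OF 1 st(2) ne(1)] eq show False by (simp add: insep_refl)
        next
          case 2 from fsep[OF 2 st(1)] ne(1) eq show False by (metis insep_refl \<open>p = (s, n)\<close> \<open>q = (t, m)\<close>)
        qed
      qed
    qed (use f0 in auto)
    then show "f p = f q \<longleftrightarrow> (p, q) \<in> hedgehog_rel"
      using st by (auto simp: hedgehog_rel_def topspace_hedgehog_base)
  qed
qed

section \<open>Increasing bijections of the line\<close>

text \<open>Such a map is automatically a homeomorphism. Total functions on the line stand for the
  homeomorphisms of an interval that fix its ends, extended by the identity.\<close>

definition incr_bij :: "(real \<Rightarrow> real) \<Rightarrow> bool" where
  "incr_bij h \<longleftrightarrow> strict_mono h \<and> surj h"

definition fixes_off :: "real \<Rightarrow> real \<Rightarrow> (real \<Rightarrow> real) \<Rightarrow> bool" where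
  "fixes_off a b h \<longleftrightarrow> (\<forall>u. u \<le> a \<or> b \<le> u \<longrightarrow> h u = u)"

lemma incr_bij_less_iff: "incr_bij h \<Longrightarrow> h x < h y \<longleftrightarrow> x < y"
  by (simp add: incr_bij_def strict_mono_less)

lemma incr_bij_le_iff: "incr_bij h \<Longrightarrow> h x \<le> h y \<longleftrightarrow> x \<le> y"
  by (simp add: incr_bij_def strict_mono_less_eq)

lemma incr_bij_id: "incr_bij (\<lambda>x. x)"
  by (simp add: incr_bij_def strict_mono_def surj_def)

lemma incr_bij_comp: "incr_bij g \<Longrightarrow> incr_bij h \<Longrightarrow> incr_bij (g \<circ> h)"
  unfolding incr_bij_def using comp_surj[of h g] by (simp add: strict_mono_def)

lemma incr_bij_inv: assumes "incr_bij h" shows "incr_bij (inv h)"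
proof -
  have h: "h (inv h x) = x" for x
    using assms by (simp add: incr_bij_def surj_f_inv_f)
  have "inj h" using assms by (simp add: incr_bij_def strict_mono_imp_inj_on)
  moreover have "inv h x < inv h y" if "x < y" for x y
    using that incr_bij_less_iff[OF assms, of "inv h x" "inv h y"] by (simp add: h)
  ultimately show ?thesis
    by (simp add: incr_bij_def strict_mono_def inj_imp_surj_inv)
qed

lemma incr_bij_continuous: assumes "incr_bij h" shows "continuous_on A h"
proof -
  have "continuous_on UNIV h"
    using assms by (intro continuous_onI_mono) (auto simp: incr_bij_def strict_mono_less_eq)
  then show ?thesis by (rule continuous_on_subset) simp
qed

lemma fixes_off_id: "fixes_off a b (\<lambda>x. x)"
  by (simp add: fixes_off_def)

lemma fixes_off_mono: "fixes_off a b h \<Longrightarrow> a' \<le> a \<Longrightarrow> b \<le> b' \<Longrightarrow> fixes_off a' b' h"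
  by (auto simp: fixes_off_def)

lemma fixes_off_maps:
  assumes "incr_bij h" "fixes_off a b h" "a \<le> u" "u \<le> b"
  shows "a \<le> h u" "h u \<le> b"
  using assms incr_bij_le_iff[OF assms(1), of a u] incr_bij_le_iff[OF assms(1), of u b]
  by (auto simp: fixes_off_def)

lemma bump_exists:
  assumes "a < x" "x < b" "a < y" "y < (b::real)"
  obtains h where "incr_bij h" "fixes_off a b h" "h x = y"
proof -
  \<comment> \<open>\<open>p x y\<close> is linear from \<open>[a, x]\<close> onto
    \<open>[a, y]\<close> and from \<open>[x, b]\<close> onto \<open>[y, b]\<close>, and the
    identity elsewhere.\<close>
  define p where "p = (\<lambda>x y u. if u \<le> a then u else if u \<le> x then a + (u - a) * ((y - a) / (x - a))
     else if u \<le> b then b - (b - u) * ((b - y) / (b - x)) else u)"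
  have left: "a < a + (u - a) * ((y - a) / (x - a))" "a + (u - a) * ((y - a) / (x - a)) \<le> y"
    if "a < x" "a < y" "a < u" "u \<le> x" for x y u
  proof -
    show "a < a + (u - a) * ((y - a) / (x - a))" using that by simp
    have "(u - a) * (y - a) \<le> (x - a) * (y - a)" using that by (intro mult_right_mono) auto
    then have "(u - a) * ((y - a) / (x - a)) \<le> y - a" using that by (simp add: field_simps)
    then show "a + (u - a) * ((y - a) / (x - a)) \<le> y" by simp
  qed
  have right: "y < b - (b - u) * ((b - y) / (b - x))" "b - (b - u) * ((b - y) / (b - x)) \<le> b"
    if "x < b" "y < b" "x < u" "u \<le> b" for x y u
  proof -
    have "(b - u) * (b - y) < (b - x) * (b - y)" using that by (intro mult_strict_right_mono) auto
    then have "(b - u) * ((b - y) / (b - x)) < b - y" using that by (simp add: field_simps)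
    then show "y < b - (b - u) * ((b - y) / (b - x))" by simp
    show "b - (b - u) * ((b - y) / (b - x)) \<le> b" using that by simp
  qed
  \<comment> \<open>Exchanging \<open>x\<close> and \<open>y\<close> gives the inverse, which
    supplies surjectivity.\<close>
  have inverse: "p x y (p y x u) = u" if "a < x" "x < b" "a < y" "y < b" for x y u
  proof -
    consider "u \<le> a" | "a < u" "u \<le> y" | "y < u" "u \<le> b" | "b < u" by linarith
    then show ?thesis
    proof cases
      case 2
      define w where "w = a + (u - a) * ((x - a) / (y - a))"
      have "p y x u = w" using 2 by (simp add: p_def w_def)
      moreover have "a < w" "w \<le> x" using left[of y x u] 2 that by (auto simp: w_def)
      then have "p x y w = a + (w - a) * ((y - a) / (x - a))" by (simp add: p_def)
      moreover have "\<dots> = u" using that by (simp add: w_def)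
      ultimately show ?thesis by simp
    next
      case 3
      define w where "w = b - (b - u) * ((b - x) / (b - y))"
      have "p y x u = w" using 3 that by (simp add: p_def w_def)
      moreover have "x < w" "w \<le> b" using right[of y x u] 3 that by (auto simp: w_def)
      then have "p x y w = b - (b - w) * ((b - y) / (b - x))" using that by (simp add: p_def)
      moreover have "\<dots> = u" using that by (simp add: w_def)
      ultimately show ?thesis by simp
    qed (use that in \<open>auto simp: p_def\<close>)
  qed
  have slopes: "0 < (y - a) / (x - a)" "0 < (b - y) / (b - x)" using assms by simp_all
  have mono: "p x y u < p x y v" if "u < v" for u v
  proof -
    have "(u - a) * ((y - a) / (x - a)) < (v - a) * ((y - a) / (x - a))"
         "(b - v) * ((b - y) / (b - x)) < (b - u) * ((b - y) / (b - x))"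
      using that slopes by (simp_all add: mult_strict_right_mono del: times_divide_eq_right)
    then show ?thesis
      using that assms left[of x y u] right[of x y u] left[of x y v] right[of x y v]
      unfolding p_def by (smt (verit))
  qed
  show thesis
  proof (rule that[of "p x y"])
    show "incr_bij (p x y)"
      unfolding incr_bij_def strict_mono_def surj_def using mono inverse assms by metis
    show "fixes_off a b (p x y)" using assms by (auto simp: fixes_off_def p_def)
    show "p x y x = y" using assms by (simp add: p_def)
  qed
qed

text \<open>The intervals run from right to left and may accumulate. Continuity at an accumulation
  point is implied by being an increasing bijection, so the proof checks order and
  surjectivity.\<close>

lemma glue_exists:
  fixes a b :: "nat \<Rightarrow> real" and h :: "nat \<Rightarrow> real \<Rightarrow> real"
  assumes ab: "\<And>n. a n \<le> b n" "\<And>n. b (Suc n) < a n"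
    and h: "\<And>n. incr_bij (h n)" "\<And>n. fixes_off (a n) (b n) (h n)"
  obtains g where "incr_bij g" "\<And>n u. u \<in> {a n..b n} \<Longrightarrow> g u = h n u"
    "\<And>u. (\<And>n. u \<notin> {a n..b n}) \<Longrightarrow> g u = u"
proof -
  have lt: "b m < a n" if "n < m" for n m
    using that
  proof (induction rule: less_Suc_induct)
    case (1 i) show ?case by (rule ab)
  next
    case (2 i j k) then show ?case using ab(1)[of j] by simp
  qed
  have uniq: "n = m" if "u \<in> {a n..b n}" "u \<in> {a m..b m}" for u n m
    using lt[of n m] lt[of m n] that by (cases n m rule: linorder_cases) auto
  define g where "g = (\<lambda>u. if \<exists>n. u \<in> {a n..b n} then h (THE n. u \<in> {a n..b n}) u else u)"
  have g_in: "g u = h n u" if "u \<in> {a n..b n}" for u n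
  proof -
    have "(THE n. u \<in> {a n..b n}) = n" using that uniq by (intro the_equality) blast+
    then show ?thesis using that unfolding g_def by metis
  qed
  have g_out: "g u = u" if "\<And>n. u \<notin> {a n..b n}" for u
  proof -
    have "\<not> (\<exists>n. u \<in> {a n..b n})" using that by blast
    then show ?thesis unfolding g_def by (rule if_not_P)
  qed
  have maps: "h n u \<in> {a n..b n}" if "u \<in> {a n..b n}" for n u
    using fixes_off_maps[OF h] that by simp
  have mono: "g u < g v" if "u < v" for u v
  proof (cases "\<exists>n. u \<in> {a n..b n}")
    case True
    then obtain n where n: "u \<in> {a n..b n}" by blast
    note gu = g_in[OF n] maps[OF n]
    show ?thesis
    proof (cases "\<exists>m. v \<in> {a m..b m}")
      case True
      then obtain m where m: "v \<in> {a m..b m}" by blast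
      note gv = g_in[OF m] maps[OF m]
      show ?thesis
        using lt[of n m] lt[of m n] gu gv n m that incr_bij_less_iff[OF h(1), of n u v]
        by (cases n m rule: linorder_cases) auto
    next
      case False
      then have "g v = v" "v \<notin> {a n..b n}" using g_out by auto
      with gu n that show ?thesis by auto
    qed
  next
    case False
    then have gu: "g u = u" using g_out by blast
    show ?thesis
    proof (cases "\<exists>m. v \<in> {a m..b m}")
      case True
      then obtain m where m: "v \<in> {a m..b m}" by blast
      have "u \<notin> {a m..b m}" using False by blast
      with gu g_in[OF m] maps[OF m] m that show ?thesis by auto
    next
      case False
      then have "g v = v" using g_out by blast
      with gu that show ?thesis by simp
    qed
  qed
  have "\<exists>u. g u = v" for v
  proof (cases "\<exists>n. v \<in> {a n..b n}")
    case True
    then obtain n where n: "v \<in> {a n..b n}" by blast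
    obtain u where u: "h n u = v" using h(1)[of n] by (metis incr_bij_def surjD)
    have "u \<in> {a n..b n}"
      using u n incr_bij_le_iff[OF h(1), of n "a n" u] incr_bij_le_iff[OF h(1), of n u "b n"] h(2)[of n]
      by (auto simp: fixes_off_def)
    with g_in u show ?thesis by metis
  next
    case False
    with g_out show ?thesis by blast
  qed
  then have "incr_bij g"
    using mono unfolding incr_bij_def strict_mono_def surj_def by metis
  then show thesis using g_in g_out by (rule that)
qed

section \<open>Partition sums along an equivariantly embedded arc\<close>

text \<open>The summands have the form \<open>- i x + i y\<close> rather than \<open>i y - i x\<close> so that consecutive ones telescope from
  the left in a noncommutative group.\<close>

inductive psum :: "(real \<Rightarrow> 'g::group_add) \<Rightarrow> real \<Rightarrow> nat \<Rightarrow> real \<Rightarrow> real \<Rightarrow> 'g \<Rightarrow> bool"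
  for i :: "real \<Rightarrow> 'g" and \<delta> :: real where
  nil: "psum i \<delta> 0 a a 0"
| full: "a \<le> m \<Longrightarrow> psum i \<delta> N m b g \<Longrightarrow> psum i \<delta> (Suc N) a b (- i a + i m + g)"
| gap: "a \<le> m \<Longrightarrow> m - a \<le> \<delta> \<Longrightarrow> psum i \<delta> N m b g \<Longrightarrow> psum i \<delta> (Suc N) a b g"

lemma psum_le: "psum i \<delta> N a b g \<Longrightarrow> a \<le> b"
  by (induction rule: psum.induct) auto

text \<open>Prefixing the degenerate interval \<open>[a, a]\<close> adds 0, so the count is an upper
  bound on the number of steps.\<close>

lemma psum_Suc: "psum i \<delta> N a b g \<Longrightarrow> psum i \<delta> (Suc N) a b g"
  using psum.full[of a a i \<delta> N b g] by simp

lemma psum_mono_count: assumes "psum i \<delta> N a b g" "N \<le> M" shows "psum i \<delta> M a b g"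
  using assms(2) by (induction rule: dec_induct) (auto intro: assms psum_Suc)

lemma psum_mono_gap: "psum i \<delta> N a b g \<Longrightarrow> \<delta> \<le> \<delta>' \<Longrightarrow> psum i \<delta>' N a b g"
  by (induction rule: psum.induct) (auto intro: psum.intros)

lemma psum_append: "psum i \<delta> N a m g \<Longrightarrow> psum i \<delta> M m b g' \<Longrightarrow> psum i \<delta> (N + M) a b (g + g')"
  by (induction rule: psum.induct) (auto intro: psum.intros simp: add.assoc[of _ _ g'] simp del: add_uminus_conv_diff)

text \<open>On the arc rescaled to \<open>[0, 2]\<close>, the half \<open>[0, 1]\<close> carries the
  sums and \<open>[1, 2]\<close> is kept free for markers that tell the spines apart.
  \<open>E\<close> is the action of the homeomorphisms fixing both ends.\<close>

locale equivariant_arc =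
  fixes i :: "real \<Rightarrow> 'g::topological_group_add"
    and E :: "(real \<Rightarrow> real) \<Rightarrow> 'g \<Rightarrow> 'g"
  assumes cont_i: "continuous_on {0..2} i"
    and not_insep_i: "x \<in> {0..2} \<Longrightarrow> y \<in> {0..2} \<Longrightarrow> x \<noteq> y \<Longrightarrow> \<not> insep (i x) (i y)"
    and E_cont: "incr_bij h \<Longrightarrow> fixes_off 0 2 h \<Longrightarrow> continuous_on UNIV (E h)"
    and E_add: "incr_bij h \<Longrightarrow> fixes_off 0 2 h \<Longrightarrow> E h (a + b) = E h a + E h b"
    and E_i: "incr_bij h \<Longrightarrow> fixes_off 0 2 h \<Longrightarrow> t \<in> {0..2} \<Longrightarrow> E h (i t) = i (h t)"
    and E_comp: "incr_bij g \<Longrightarrow> fixes_off 0 2 g \<Longrightarrow> incr_bij h \<Longrightarrow> fixes_off 0 2 h \<Longrightarrow>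
      E (g \<circ> h) a = E g (E h a)"
begin

lemma E_zero: "incr_bij h \<Longrightarrow> fixes_off 0 2 h \<Longrightarrow> E h 0 = 0"
  using E_add[of h 0 0] by (metis add.right_neutral add_left_cancel)

lemma E_uminus: assumes "incr_bij h" "fixes_off 0 2 h" shows "E h (- x) = - E h x"
  using E_add[OF assms, of "-x" x] E_zero[OF assms] by (simp add: eq_neg_iff_add_eq_0)

lemma E_piece:
  assumes "incr_bij h" "fixes_off 0 2 h" "x \<in> {0..2}" "y \<in> {0..2}"
  shows "E h (- i x + i y) = - i (h x) + i (h y)"
  using E_i[OF assms(1,2,3)] E_i[OF assms(1,2,4)]
  by (simp add: E_add E_uminus assms(1,2))

lemma insep_E:
  assumes "incr_bij h" "fixes_off 0 2 h" "insep x y" shows "insep (E h x) (E h y)"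
  unfolding insep_def
proof (intro allI impI, elim conjE)
  fix U :: "'g set" assume U: "open U" "0 \<in> U"
  have "open (E h -` U)" using U assms by (intro open_vimage E_cont)
  moreover have "0 \<in> E h -` U" using U E_zero assms by simp
  ultimately have "-x + y \<in> E h -` U" using assms(3) by (auto simp: insep_def)
  then show "- E h x + E h y \<in> U" by (simp add: E_add E_uminus assms)
qed

text \<open>An invariance property that serves in place of membership in the subgroup generated by
  the points of the arc over \<open>[a, b]\<close>.\<close>

definition supported :: "real \<Rightarrow> real \<Rightarrow> 'g \<Rightarrow> bool" where
  "supported a b g \<longleftrightarrow> (\<forall>h. incr_bij h \<and> fixes_off 0 2 h \<and> (\<forall>u\<in>{a..b}. h u = u) \<longrightarrow> E h g = g)"

text \<open>\<open>inv k \<circ> h\<close> is the identity on \<open>[a, b]\<close> and therefore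
  fixes \<open>g\<close>; applying \<open>E k\<close> gives the claim.\<close>

lemma supported_E_eq:
  assumes "supported a b g" "incr_bij h" "fixes_off 0 2 h" "incr_bij k" "fixes_off 0 2 k"
    and eq: "\<And>u. u \<in> {a..b} \<Longrightarrow> h u = k u"
  shows "E h g = E k g"
proof -
  let ?l = "inv k \<circ> h"
  have k: "k (inv k u) = u" "inv k (k u) = u" for u
    using assms(4) by (auto simp: incr_bij_def surj_f_inv_f strict_mono_imp_inj_on inv_f_f)
  have "inv k u = u" if "k u = u" for u using k(2)[of u] that by simp
  then have l: "incr_bij ?l" "fixes_off 0 2 ?l"
    using assms by (auto intro: incr_bij_comp incr_bij_inv simp: fixes_off_def)
  have "E ?l g = g"
    using assms(1) l eq by (simp add: supported_def k)
  moreover have "k \<circ> ?l = h" by (auto simp: k)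
  ultimately show ?thesis using E_comp[OF assms(4,5) l, of g] by simp
qed

lemma supported_zero: "supported a b 0"
  by (simp add: supported_def E_zero)

lemma supported_add: "supported a b x \<Longrightarrow> supported a b y \<Longrightarrow> supported a b (x + y)"
  by (simp add: supported_def E_add)

lemma supported_mono: "supported a b x \<Longrightarrow> a' \<le> a \<Longrightarrow> b \<le> b' \<Longrightarrow> supported a' b' x"
  unfolding supported_def by (meson atLeastatMost_subset_iff subsetD)

lemma supported_piece:
  assumes "0 \<le> a" "b \<le> 2" "x \<in> {a..b}" "y \<in> {a..b}" shows "supported a b (- i x + i y)"
  using assms by (auto simp: supported_def E_piece simp del: add_uminus_conv_diff)

end

section \<open>Paths that open up the pairs of a partition sum\<close>

context equivariant_arc
begin

lemma i_near:
  assumes "open U" "i x \<in> U" "x \<in> {0..2}"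
  obtains d where "d > 0" "\<And>y. y \<in> {0..2} \<Longrightarrow> \<bar>y - x\<bar> < d \<Longrightarrow> i y \<in> U"
proof -
  have "openin (top_of_set {0..2}) ({0..2} \<inter> i -` U)"
    using continuous_openin_preimage_gen[OF cont_i assms(1)] .
  then have "\<exists>e>0. \<forall>y\<in>{0..2}. dist y x < e \<longrightarrow> y \<in> {0..2} \<inter> i -` U"
    using assms unfolding openin_euclidean_subtopology_iff by blast
  then show thesis using that by (auto simp: dist_real_def)
qed

text \<open>The last clause says that one homeomorphism moving only points of \<open>[a, b]\<close>
  accelerates the path so much that all of \<open>[\<epsilon>, 1]\<close> is sent close to
  \<open>g\<close>.\<close>

definition spine_to :: "real \<Rightarrow> real \<Rightarrow> 'g \<Rightarrow> (real \<Rightarrow> 'g) \<Rightarrow> bool" where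
  "spine_to a b g \<gamma> \<longleftrightarrow> continuous_on {0..1} \<gamma> \<and> \<gamma> 0 = 0 \<and> (\<forall>t\<in>{0..1}. supported a b (\<gamma> t)) \<and>
    (\<forall>\<epsilon> U. 0 < \<epsilon> \<and> open U \<and> g \<in> U \<longrightarrow>
       (\<exists>h. incr_bij h \<and> fixes_off a b h \<and> (\<forall>t\<in>{\<epsilon>..1}. E h (\<gamma> t) \<in> U)))"

text \<open>Every kept pair \<open>- i a + i m\<close> is replaced by \<open>- i a + i (e t)\<close>
  with \<open>e t\<close> running from \<open>a\<close> to \<open>m\<close>. Pushing
  \<open>e \<epsilon>\<close> towards \<open>m\<close> brings this summand near its final value; the
  summands live on adjacent intervals, so they are pushed independently.\<close>

lemma psum_path:
  assumes "psum i \<delta> N a b g" "0 \<le> a" "b \<le> 2"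
  shows "\<exists>\<gamma>. spine_to a b g \<gamma>"
  using assms
proof (induction rule: psum.induct)
  case (nil a)
  show ?case
    by (rule exI[of _ "\<lambda>_. 0"])
      (auto simp: spine_to_def supported_zero E_zero[OF incr_bij_id fixes_off_id] intro!: exI[of _ "\<lambda>x. x"] incr_bij_id fixes_off_id)
next
  case (gap a m N b g)
  then have "0 \<le> m" by simp
  from gap.IH[OF this gap.prems(2)] obtain \<gamma> where "spine_to m b g \<gamma>" by blast
  then have \<gamma>: "continuous_on {0..1} \<gamma>" "\<gamma> 0 = 0" "\<forall>t\<in>{0..1}. supported m b (\<gamma> t)"
    "\<forall>\<epsilon> U. 0 < \<epsilon> \<and> open U \<and> g \<in> U \<longrightarrow>
       (\<exists>h. incr_bij h \<and> fixes_off m b h \<and> (\<forall>t\<in>{\<epsilon>..1}. E h (\<gamma> t) \<in> U))"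
    by (simp_all add: spine_to_def)
  have "\<forall>t\<in>{0..1}. supported a b (\<gamma> t)"
    using \<gamma>(3) gap(1) by (auto intro: supported_mono)
  moreover have "\<forall>\<epsilon> U. 0 < \<epsilon> \<and> open U \<and> g \<in> U \<longrightarrow>
       (\<exists>h. incr_bij h \<and> fixes_off a b h \<and> (\<forall>t\<in>{\<epsilon>..1}. E h (\<gamma> t) \<in> U))"
    using \<gamma>(4) gap(1) by (meson fixes_off_mono order_refl)
  ultimately show ?case using \<gamma>(1,2) unfolding spine_to_def by blast
next
  case (full a m N b g)
  have mb: "m \<le> b" using full.hyps psum_le by blast
  have "0 \<le> m" using full by simp
  from full.IH[OF this full.prems(2)] obtain \<gamma> where "spine_to m b g \<gamma>" by blast
  then have \<gamma>: "continuous_on {0..1} \<gamma>" "\<gamma> 0 = 0" "\<forall>t\<in>{0..1}. supported m b (\<gamma> t)"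
    "\<forall>\<epsilon> U. 0 < \<epsilon> \<and> open U \<and> g \<in> U \<longrightarrow>
       (\<exists>h. incr_bij h \<and> fixes_off m b h \<and> (\<forall>t\<in>{\<epsilon>..1}. E h (\<gamma> t) \<in> U))"
    by (simp_all add: spine_to_def)
  show ?case
  proof (cases "a = m")
    case True
    then show ?thesis using \<gamma> by (auto simp: spine_to_def)
  next
    case False
    with full have am: "a < m" by simp
    define e where "e = (\<lambda>t. a + t * (m - a))"
    have e: "e t \<in> {a..m}" "e t \<in> {a..b}" "e t \<in> {0..2}" if "t \<in> {0..1}" for t
    proof -
      have "e t = m - (1 - t) * (m - a)" by (simp add: e_def algebra_simps)
      moreover have "0 \<le> (1 - t) * (m - a)" using that am by simp
      ultimately have "e t \<le> m" by simp
      moreover have "a \<le> e t" using that am by (simp add: e_def)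
      ultimately show "e t \<in> {a..m}" by simp
      then show "e t \<in> {a..b}" "e t \<in> {0..2}" using mb full.prems by auto
    qed
    define \<gamma>' where "\<gamma>' = (\<lambda>t. - i a + i (e t) + \<gamma> t)"
    have "continuous_on {0..1} (\<lambda>t. i (e t))"
      by (rule continuous_on_compose2[OF cont_i]) (use e in \<open>auto simp: e_def intro!: continuous_intros\<close>)
    then have "continuous_on {0..1} \<gamma>'"
      unfolding \<gamma>'_def by (intro continuous_intros \<gamma>(1))
    moreover have "\<gamma>' 0 = 0" by (simp add: \<gamma>'_def e_def \<gamma>(2))
    moreover have "\<forall>t\<in>{0..1}. supported a b (\<gamma>' t)"
    proof
      fix t :: real assume t: "t \<in> {0..1}"
      have "supported a b (\<gamma> t)" by (rule supported_mono[of m b]) (use \<gamma>(3) t am in auto)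
      moreover have "supported a b (- i a + i (e t))"
        by (rule supported_piece) (use e(2)[OF t] full.prems am mb in auto)
      ultimately show "supported a b (\<gamma>' t)" unfolding \<gamma>'_def by (rule supported_add[rotated])
    qed
    moreover have "\<exists>h. incr_bij h \<and> fixes_off a b h \<and> (\<forall>t\<in>{\<epsilon>..1}. E h (\<gamma>' t) \<in> U)"
      if "0 < \<epsilon>" and U: "open U" "- i a + i m + g \<in> U" for \<epsilon> U
    proof -
      obtain A B where AB: "open A" "open B" "- i a + i m \<in> A" "g \<in> B" "\<forall>u\<in>A. \<forall>v\<in>B. u + v \<in> U"
        using open_add_split[OF U] by blast
      obtain h' where h': "incr_bij h'" "fixes_off m b h'" "\<forall>t\<in>{\<epsilon>..1}. E h' (\<gamma> t) \<in> B"
        using \<gamma>(4) \<open>0 < \<epsilon>\<close> AB(2,4) by blast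
      have "open {z. - i a + z \<in> A}" "i m \<in> {z. - i a + z \<in> A}" "m \<in> {0..2}"
        using AB open_left_translation(1)[OF AB(1)] full mb by auto
      from i_near[OF this] obtain d where d: "d > 0"
        "\<And>y. y \<in> {0..2} \<Longrightarrow> \<bar>y - m\<bar> < d \<Longrightarrow> - i a + i y \<in> A" by auto
      \<comment> \<open>The cap \<open>1/2\<close> keeps \<open>x\<close> strictly below
        \<open>m\<close> even for large \<epsilon>, as the bump requires.\<close>
      define x where "x = e (min \<epsilon> (1/2))"
      have x: "a < x" "x < m"
      proof -
        show "a < x" using am that(1) by (simp add: x_def e_def)
        have "min \<epsilon> (1/2) * (m - a) < 1 * (m - a)" using am by (intro mult_strict_right_mono) auto
        then show "x < m" by (simp add: x_def e_def)
      qed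
      define y where "y = max ((a + m) / 2) (m - d / 2)"
      have y: "a < y" "y < m" "m - d < y" using am d(1) by (auto simp: y_def max_def)
      obtain k where k: "incr_bij k" "fixes_off a m k" "k x = y"
        by (rule bump_exists[OF x(1,2) y(1,2)])
      have k2: "fixes_off 0 2 k" and h'2: "fixes_off 0 2 h'"
        using k h' fixes_off_mono full mb am by auto
      \<comment> \<open>Both maps fix \<open>m\<close> and move points on opposite sides of it
        only.\<close>
      have comm: "k \<circ> h' = h' \<circ> k"
      proof
        fix u
        show "(k \<circ> h') u = (h' \<circ> k) u"
        proof (cases "u \<le> m")
          case True
          then have "k u \<le> m" using k incr_bij_le_iff[OF k(1), of u m] by (auto simp: fixes_off_def)
          then show ?thesis using True h'(2) by (simp add: fixes_off_def)
        next
          case False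
          then have "m \<le> h' u" using h' incr_bij_le_iff[OF h'(1), of m u] by (auto simp: fixes_off_def)
          then show ?thesis using False k(2) by (simp add: fixes_off_def)
        qed
      qed
      let ?h = "k \<circ> h'"
      have h: "incr_bij ?h" "fixes_off a b ?h" "fixes_off 0 2 ?h"
        using k h' k2 h'2 am mb by (auto intro: incr_bij_comp simp: fixes_off_def)
      have "E ?h (\<gamma>' t) \<in> U" if t: "t \<in> {\<epsilon>..1}" for t
      proof -
        have t01: "t \<in> {0..1}" using t \<open>0 < \<epsilon>\<close> by auto
        have "E ?h (\<gamma> t) = E h' (E k (\<gamma> t))" unfolding comm by (rule E_comp) (use h' h'2 k k2 in auto)
        moreover have "E k (\<gamma> t) = \<gamma> t"
          using \<gamma>(3) t01 k k2 by (auto simp: supported_def fixes_off_def)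
        ultimately have "E ?h (\<gamma> t) \<in> B" using h'(3) t by simp
        moreover have "?h a = a" "?h (e t) = k (e t)"
          using h'(2) k(2) e(1)[OF t01] am by (auto simp: fixes_off_def)
        then have "E ?h (- i a + i (e t)) = - i a + i (k (e t))"
          using E_piece[OF h(1,3), of a "e t"] e(3)[OF t01] full am mb by auto
        moreover have "- i a + i (k (e t)) \<in> A"
        proof (rule d(2))
          have "x \<le> e t" using t am by (auto simp: x_def e_def intro!: mult_right_mono)
          then have "y \<le> k (e t)" using k incr_bij_le_iff[OF k(1), of x "e t"] by simp
          moreover have "k (e t) \<le> m" using e(1)[OF t01] k incr_bij_le_iff[OF k(1), of "e t" m]
            by (auto simp: fixes_off_def)
          ultimately show "k (e t) \<in> {0..2}" "\<bar>k (e t) - m\<bar> < d" using y full mb by auto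
        qed
        ultimately show ?thesis
          using AB(5) by (simp add: \<gamma>'_def E_add[OF h(1,3)])
      qed
      with h show ?thesis by blast
    qed
    ultimately show ?thesis unfolding spine_to_def by blast
  qed
qed

text \<open>To make the spines disjoint and injective, a small piece inside \<open>[1, 2]\<close> with a moving endpoint
  \<open>w n t\<close> is added. A homeomorphism moving only this point distinguishes any two elements.\<close>

lemma hedgehog_of_core:
  fixes \<gamma> :: "nat \<Rightarrow> real \<Rightarrow> 'g"
  assumes cont: "\<And>n. continuous_on {0..1} (\<gamma> n)"
    and zero: "\<And>n. \<gamma> n 0 = 0"
    and supp: "\<And>n t. t \<in> {0..1} \<Longrightarrow> supported 0 1 (\<gamma> n t)"
    and U: "open U" "0 \<in> U"
    and expand: "\<And>\<epsilon>. (\<And>n. \<epsilon> n > 0) \<Longrightarrow>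
      \<exists>h. incr_bij h \<and> fixes_off 0 1 h \<and> (\<forall>n t. \<epsilon> n \<le> t \<and> t \<le> 1 \<longrightarrow> E h (\<gamma> n t) \<notin> U)"
  shows "\<exists>S :: 'g set. top_of_set S homeomorphic_space sequential_hedgehog"
proof -
  obtain V where V: "open V" "0 \<in> V" "\<forall>x\<in>V. -x \<in> V" "\<forall>x\<in>V. \<forall>y\<in>V. x + y \<in> U"
    using nhds_zero_half[OF U] by blast
  obtain V' where V': "open V'" "0 \<in> V'" "\<forall>x\<in>V'. -x \<in> V'" "\<forall>x\<in>V'. \<forall>y\<in>V'. x + y \<in> V"
    using nhds_zero_half[OF V(1,2)] by blast
  obtain d where d: "d > 0" "\<And>y. y \<in> {0..2} \<Longrightarrow> \<bar>y - 1\<bar> < d \<Longrightarrow> - i 1 + i y \<in> V'"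
    using i_near[of "{z. - i 1 + z \<in> V'}" 1] open_left_translation(1)[OF V'(1)] V' by auto
  \<comment> \<open>Increments inside \<open>[1, 1 + \<eta>]\<close> are to lie in \<open>V\<close>,
    so that adding one to an element outside \<open>U\<close> leaves it outside
    \<open>V\<close>.\<close>
  define \<eta> where "\<eta> = min (d/2) (1/2)"
  have \<eta>: "0 < \<eta>" "\<eta> < d" "\<eta> < 1" using d by (auto simp: \<eta>_def)
  have small: "- i x + i y \<in> V" if "x \<in> {1..1+\<eta>}" "y \<in> {1..1+\<eta>}" for x y
  proof -
    have "- i 1 + i x \<in> V'" "- i 1 + i y \<in> V'" by (intro d(2); use that \<eta> in auto)+
    then have "-(- i 1 + i x) + (- i 1 + i y) \<in> V" using V' by blast
    then show ?thesis by (simp add: minus_add add.assoc)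
  qed
  \<comment> \<open>Marker \<open>n\<close> runs from \<open>1 + \<eta> * (1/4)^n / 2\<close> to
    \<open>1 + \<eta> * (1/4)^n\<close>; the ratio \<open>1/4\<close>, smaller than the factor
    \<open>1/2\<close>, makes these intervals disjoint.\<close>
  define w where "w = (\<lambda>n t. 1 + \<eta> * (1/4)^n * (1 + t) / 2)"
  have w: "1 + \<eta> * (1/4)^n / 2 \<le> w n t" "w n t \<le> 1 + \<eta> * (1/4)^n" "w n t \<in> {1<..1+\<eta>}" if "t \<in> {0..1}" for n t
  proof -
    have p: "0 < \<eta> * (1/4)^n" using \<eta> by simp
    then have "\<eta> * (1/4)^n * 1 \<le> \<eta> * (1/4)^n * (1 + t)" "\<eta> * (1/4)^n * (1 + t) \<le> \<eta> * (1/4)^n * 2"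
      by (intro mult_left_mono; use that in auto)+
    then show *: "1 + \<eta> * (1/4)^n / 2 \<le> w n t" "w n t \<le> 1 + \<eta> * (1/4)^n" by (auto simp: w_def)
    have "\<eta> * (1/4)^n \<le> \<eta> * 1" using \<eta> by (intro mult_left_mono power_le_one) auto
    with * p show "w n t \<in> {1<..1+\<eta>}" by auto
  qed
  have w_less: "w m t < w n s" if "n < m" "s \<in> {0..1}" "t \<in> {0..1}" for n m s t
  proof -
    have "(1/4::real)^m \<le> (1/4)^Suc n" using that by (intro power_decreasing) auto
    then have "\<eta> * (1/4)^m \<le> \<eta> * ((1/4)^n / 4)" using \<eta> by simp
    moreover have "0 < \<eta> * (1/4)^n" using \<eta> by simp
    ultimately show ?thesis using w(2)[OF that(3), of m] w(1)[OF that(2), of n] by linarith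
  qed
  have w_inj: "n = m \<and> s = t" if "w n s = w m t" "s \<in> {0..1}" "t \<in> {0..1}" for n m s t
  proof -
    have "n = m" using w_less[of n m s t] w_less[of m n t s] that by (cases n m rule: linorder_cases) auto
    then show ?thesis using that \<eta> by (simp add: w_def)
  qed
  have w02: "w n t \<in> {0..2}" if "t \<in> {0..1}" for n t using w(3)[OF that, of n] \<eta> by auto
  have w_cont: "continuous_on {0..1} (w n)" for n unfolding w_def by (intro continuous_intros) auto
  have z01: "(0::real) \<in> {0..1}" by simp
  define \<Gamma> where "\<Gamma> = (\<lambda>n t. \<gamma> n t + (- i (w n 0) + i (w n t)))"
  show ?thesis
  proof (rule hedgehog_of_spines[of \<Gamma>])
    fix n
    have "continuous_on {0..1} (\<lambda>t. i (w n t))"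
      by (rule continuous_on_compose2[OF cont_i w_cont]) (use w02 in auto)
    then show "continuous_on {0..1} (\<Gamma> n)"
      unfolding \<Gamma>_def by (intro continuous_intros cont)
    show "\<Gamma> n 0 = 0" by (simp add: \<Gamma>_def zero)
  next
    fix \<epsilon> :: "nat \<Rightarrow> real" assume "\<And>n. \<epsilon> n > 0"
    then obtain h where h: "incr_bij h" "fixes_off 0 1 h" "\<And>n t. \<epsilon> n \<le> t \<Longrightarrow> t \<le> 1 \<Longrightarrow> E h (\<gamma> n t) \<notin> U"
      using expand by blast
    have h2: "fixes_off 0 2 h" using h(2) by (rule fixes_off_mono) auto
    have "E h (\<Gamma> n t) \<notin> V" if "\<epsilon> n \<le> t" "t \<le> 1" for n t
    proof
      assume *: "E h (\<Gamma> n t) \<in> V"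
      have t: "t \<in> {0..1}" using that \<open>\<And>n. \<epsilon> n > 0\<close>[of n] by auto
      have "h (w n t) = w n t" "h (w n 0) = w n 0"
        using h(2) w(3)[OF t, of n] w(3)[OF z01, of n] by (auto simp: fixes_off_def)
      then have "E h (\<Gamma> n t) = E h (\<gamma> n t) + (- i (w n 0) + i (w n t))"
        unfolding \<Gamma>_def using E_add[OF h(1) h2] E_piece[OF h(1) h2 w02[OF z01] w02[OF t]] by metis
      then have "E h (\<gamma> n t) = E h (\<Gamma> n t) + (- i (w n t) + i (w n 0))"
        by (simp add: add.assoc)
      moreover have "- i (w n t) + i (w n 0) \<in> V"
        using w(3)[OF t, of n] w(3)[OF z01, of n] by (intro small) auto
      ultimately have "E h (\<gamma> n t) \<in> U" using V(4) * by simp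
      with h(3) that show False by blast
    qed
    moreover have "open (E h -` V)" by (intro open_vimage V E_cont h h2)
    ultimately show "\<exists>V. open V \<and> 0 \<in> V \<and> (\<forall>n t. \<epsilon> n \<le> t \<and> t \<le> 1 \<longrightarrow> \<Gamma> n t \<notin> V)"
      using V(2) E_zero[OF h(1) h2] by (intro exI[of _ "E h -` V"]) auto
  next
    fix n m :: nat and s t :: real
    assume s: "s \<in> {0<..1}" and t: "t \<in> {0..1}" and ne: "(n, s) \<noteq> (m, t)"
    have s': "s \<in> {0..1}" using s by auto
    \<comment> \<open>Points that the bump has to fix: the markers entering the other element, the
      starting marker \<open>w n 0\<close>, and 1 and 2, which confine the bump to
      \<open>[1, 2]\<close>.\<close>
    let ?F = "{1, 2, w n 0, w m 0, w m t}"
    have "w n s \<notin> ?F"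
      using w_inj[of n s n 0] w_inj[of n s m 0] w_inj[of n s m t] ne s s' t w(3)[OF s', of n] \<eta> by auto
    then have "open (- ?F)" "w n s \<in> - ?F" by (simp_all add: finite_imp_closed open_Compl)
    then obtain r where r: "r > 0" "\<And>y. dist y (w n s) < r \<Longrightarrow> y \<notin> ?F"
      unfolding open_dist by blast
    have "w n s - r < w n s" "w n s < w n s + r" "w n s - r < w n s + r / 2" "w n s + r / 2 < w n s + r"
      using r(1) by auto
    then obtain k where k: "incr_bij k" "fixes_off (w n s - r) (w n s + r) k" "k (w n s) = w n s + r / 2"
      by (rule bump_exists)
    have kF: "k u = u" if "u \<in> ?F" for u
    proof -
      have "\<not> dist u (w n s) < r" using r(2) that by blast
      then have "u \<le> w n s - r \<or> w n s + r \<le> u" unfolding dist_real_def by linarith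
      then show ?thesis using k(2) unfolding fixes_off_def by blast
    qed
    have r12: "1 \<le> w n s - r" "w n s + r \<le> 2"
    proof -
      have "\<not> dist 1 (w n s) < r" "\<not> dist 2 (w n s) < r" using r(2) by blast+
      then show "1 \<le> w n s - r" "w n s + r \<le> 2"
        using w(3)[OF s', of n] \<eta> by (simp_all add: dist_real_def)
    qed
    have k2: "fixes_off 0 2 k" using k(2) by (rule fixes_off_mono) (use r12 in auto)
    have k\<gamma>: "E k (\<gamma> n' t') = \<gamma> n' t'" if "t' \<in> {0..1}" for n' t'
      using supp[OF that, of n'] k k2 r12 by (auto simp: supported_def fixes_off_def)
    have "E k (\<Gamma> n s) = \<gamma> n s + (- i (w n 0) + i (w n s + r / 2))"
      unfolding \<Gamma>_def using E_add[OF k(1) k2] E_piece[OF k(1) k2 w02[OF z01] w02[OF s']] k\<gamma>[OF s'] k(3) kF[of "w n 0"]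
      by (metis insertCI)
    then have 1: "- \<Gamma> n s + E k (\<Gamma> n s) = - i (w n s) + i (w n s + r / 2)"
      by (simp only: \<Gamma>_def minus_add minus_minus add.assoc minus_add_cancel add_minus_cancel)
    have "E k (\<Gamma> m t) = \<Gamma> m t"
      unfolding \<Gamma>_def using E_add[OF k(1) k2] E_piece[OF k(1) k2 w02[OF z01] w02[OF t]] k\<gamma>[OF t] kF[of "w m 0"] kF[of "w m t"]
      by (metis insertCI)
    \<comment> \<open>\<open>E k\<close> fixes \<open>\<Gamma> m t\<close> but displaces
      \<open>\<Gamma> n s\<close>. If the two were inseparable, so would be
      \<open>\<Gamma> n s\<close> and its image, which differ by an increment of the arc between
      distinct points.\<close>
    show "\<not> insep (\<Gamma> n s) (\<Gamma> m t)"
    proof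
      assume *: "insep (\<Gamma> n s) (\<Gamma> m t)"
      from insep_E[OF k(1) k2 this] have "insep (E k (\<Gamma> n s)) (\<Gamma> m t)"
        using \<open>E k (\<Gamma> m t) = \<Gamma> m t\<close> by simp
      then have "insep (\<Gamma> n s) (E k (\<Gamma> n s))"
        using * insep_sym insep_trans by blast
      then have "insep (i (w n s)) (i (w n s + r / 2))" using 1 by (simp add: insep_def)
      moreover have "w n s + r / 2 \<in> {0..2}" using r12 r(1) by auto
      ultimately show False
        using not_insep_i[OF w02[OF s', of n]] r(1) by fastforce
    qed
  qed
qed

section \<open>The case of large sums to the right of some point\<close>

text \<open>With gap bound 2, arbitrary intervals of the arc may be skipped. Large sums are chosen
  one after another, each to the left of the previous ones, and their accelerating homeomorphisms
  are glued.\<close>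

lemma hedgehog_of_large_sums:
  assumes p: "0 \<le> p" "p < 1" and U: "open U" "0 \<in> U"
    and large: "\<And>q. p < q \<Longrightarrow> \<exists>a b N g. p < a \<and> b \<le> q \<and> psum i 2 N a b g \<and> g \<notin> U"
  shows "\<exists>S :: 'g set. top_of_set S homeomorphic_space sequential_hedgehog"
proof -
  let ?P = "\<lambda>x. p < fst x \<and> snd x < 1 \<and> (\<exists>N g. psum i 2 N (fst x) (snd x) g \<and> g \<notin> U)"
  have ex: "\<exists>y. ?P y \<and> snd y < q" if "p < q" for q
  proof -
    \<comment> \<open>Aiming halfway to \<open>min q 1\<close> makes the right end strictly smaller
      than both \<open>q\<close> and 1.\<close>
    have "p < (p + min q 1) / 2" using that p by (auto simp: min_def)
    from large[OF this] obtain a b N g where *: "p < a" "b \<le> (p + min q 1) / 2" "psum i 2 N a b g" "g \<notin> U"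
      by blast
    have "(p + min q 1) / 2 < q" "(p + min q 1) / 2 < 1" using that p by (auto simp: min_def)
    with * show ?thesis by (intro exI[of _ "(a, b)"]) auto
  qed
  have "\<exists>x. \<forall>n::nat. ?P (x n) \<and> snd (x (Suc n)) < fst (x n)"
  proof (rule dependent_nat_choice)
    show "\<exists>x. ?P x" using ex[of 1] p by blast
    show "\<exists>y. ?P y \<and> snd y < fst x" if "?P x" for x and n :: nat using ex[of "fst x"] that by blast
  qed
  then obtain x where "\<forall>n::nat. ?P (x n) \<and> snd (x (Suc n)) < fst (x n)" ..
  then have x: "?P (x n)" "snd (x (Suc n)) < fst (x n)" for n by simp_all
  define a where "a = fst \<circ> x"
  define b where "b = snd \<circ> x"
  have "\<forall>n. \<exists>N g. psum i 2 N (a n) (b n) g \<and> g \<notin> U"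
    using x(1) by (simp add: a_def b_def)
  then obtain N g where ps: "\<And>n. psum i 2 (N n) (a n) (b n) (g n)" "\<And>n. g n \<notin> U"
    by metis
  have ab: "0 \<le> a n" "b n \<le> 1" "b n \<le> 2" "a n \<le> b n" "b (Suc n) < a n" for n
  proof -
    have "p < a n" "b n < 1" "b (Suc n) < a n" using x[of n] by (simp_all add: a_def b_def)
    with p psum_le[OF ps(1)[of n]] show "0 \<le> a n" "b n \<le> 1" "b n \<le> 2" "a n \<le> b n" "b (Suc n) < a n"
      by linarith+
  qed
  have "\<forall>n. \<exists>\<gamma>. spine_to (a n) (b n) (g n) \<gamma>"
    by (intro allI psum_path[OF ps(1)] ab)
  then obtain \<gamma> where "\<And>n. spine_to (a n) (b n) (g n) (\<gamma> n)"
    by metis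
  then have \<gamma>: "\<And>n. continuous_on {0..1} (\<gamma> n)" "\<And>n. \<gamma> n 0 = 0"
      "\<And>n t. t \<in> {0..1} \<Longrightarrow> supported (a n) (b n) (\<gamma> n t)"
      "\<And>n \<epsilon> U. 0 < \<epsilon> \<Longrightarrow> open U \<Longrightarrow> g n \<in> U \<Longrightarrow>
       \<exists>h. incr_bij h \<and> fixes_off (a n) (b n) h \<and> (\<forall>t\<in>{\<epsilon>..1}. E h (\<gamma> n t) \<in> U)"
    by (simp_all add: spine_to_def)
  obtain V where V: "open V" "0 \<in> V" "\<forall>x\<in>V. \<forall>y\<in>V. x + y \<in> U"
    using nhds_zero_half[OF U] by blast
  show ?thesis
  proof (rule hedgehog_of_core[of \<gamma> V])
    show "supported 0 1 (\<gamma> n t)" if "t \<in> {0..1}" for n t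
      using \<gamma>(3)[OF that] ab(1,2) by (rule supported_mono)
    fix \<epsilon> :: "nat \<Rightarrow> real" assume \<epsilon>: "\<And>n. \<epsilon> n > 0"
    \<comment> \<open>The image comes so near \<open>g n\<close> that it cannot also lie in
      \<open>V\<close>, since \<open>g n\<close> is outside \<open>U\<close>.\<close>
    have "\<exists>h. incr_bij h \<and> fixes_off (a n) (b n) h \<and> (\<forall>t\<in>{\<epsilon> n..1}. E h (\<gamma> n t) \<in> {z. g n - z \<in> V})" for n
      by (rule \<gamma>(4)) (use \<epsilon> V in \<open>auto intro: open_left_translation\<close>)
    then have "\<forall>n. \<exists>h. incr_bij h \<and> fixes_off (a n) (b n) h \<and> (\<forall>t\<in>{\<epsilon> n..1}. g n - E h (\<gamma> n t) \<in> V)"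
      by simp
    from choice[OF this] obtain h where "\<forall>n. incr_bij (h n) \<and> fixes_off (a n) (b n) (h n) \<and>
      (\<forall>t\<in>{\<epsilon> n..1}. g n - E (h n) (\<gamma> n t) \<in> V)" ..
    then have h: "\<And>n. incr_bij (h n)" "\<And>n. fixes_off (a n) (b n) (h n)"
      "\<And>n t. t \<in> {\<epsilon> n..1} \<Longrightarrow> g n - E (h n) (\<gamma> n t) \<in> V" by simp_all
    obtain k where k: "incr_bij k" "\<And>n u. u \<in> {a n..b n} \<Longrightarrow> k u = h n u"
      "\<And>u. (\<And>n. u \<notin> {a n..b n}) \<Longrightarrow> k u = u"
      by (rule glue_exists[of a b h]) (use ab h in auto)
    have k1: "fixes_off 0 1 k"
      unfolding fixes_off_def
    proof (intro allI impI)
      fix u :: real assume u: "u \<le> 0 \<or> 1 \<le> u"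
      show "k u = u"
      proof (cases "\<exists>n. u \<in> {a n..b n}")
        case True
        then obtain n where n: "u \<in> {a n..b n}" by blast
        then have "u \<le> a n \<or> b n \<le> u" using u ab(1,2)[of n] by auto
        then show ?thesis using k(2)[OF n] h(2)[of n] unfolding fixes_off_def by metis
      qed (use k(3) in blast)
    qed
    then have k2: "fixes_off 0 2 k" by (rule fixes_off_mono) auto
    have "E k (\<gamma> n t) \<notin> V" if "\<epsilon> n \<le> t" "t \<le> 1" for n t
    proof
      assume "E k (\<gamma> n t) \<in> V"
      moreover have "E k (\<gamma> n t) = E (h n) (\<gamma> n t)"
      proof (rule supported_E_eq[OF \<gamma>(3)])
        show "t \<in> {0..1}" using that \<epsilon>[of n] by auto
        show "fixes_off 0 2 (h n)" using h(2) ab(1,3) by (rule fixes_off_mono)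
      qed (use k k2 h in auto)
      ultimately have "E (h n) (\<gamma> n t) \<in> V" by simp
      moreover have "g n - E (h n) (\<gamma> n t) \<in> V" using h(3)[of t n] that by simp
      ultimately have "(g n - E (h n) (\<gamma> n t)) + E (h n) (\<gamma> n t) \<in> U" using V(3) by blast
      with ps(2) show False by simp
    qed
    with k k1 show "\<exists>h. incr_bij h \<and> fixes_off 0 1 h \<and> (\<forall>n t. \<epsilon> n \<le> t \<and> t \<le> 1 \<longrightarrow> E h (\<gamma> n t) \<notin> V)"
      by blast
  qed (use \<gamma> V in auto)
qed

end

section \<open>Singular homeomorphisms from binary cascades\<close>

lemma ex_pow2_mult_ge_1: "0 < (e::real) \<Longrightarrow> \<exists>d. 1 \<le> 2 ^ d * e"
  by (metis less_eq_real_def mult.commute pos_divide_le_eq real_arch_pow one_less_numeral_iff semiring_norm(76))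

text \<open>\<open>L p m\<close> below is the rescaled distribution function on a dyadic interval of level \<open>m\<close> whose address
  contains \<open>p\<close> ones; \<open>rho p m\<close> is the probability that the next digit is one.\<close>

locale cascade =
  fixes \<phi> :: "nat \<Rightarrow> nat" and \<tau> :: "nat \<Rightarrow> real"
  assumes mono_\<phi>: "mono \<phi>" and \<tau>: "0 < \<tau> p" "\<tau> p \<le> 1/2"
begin

definition rho :: "nat \<Rightarrow> nat \<Rightarrow> real" where
  "rho p m = (if m < \<phi> p then \<tau> p else 1/2)"

lemma rho: "0 < rho p m" "rho p m \<le> 1/2"
  using \<tau> by (auto simp: rho_def)

text \<open>The base case places the whole mass of a dyadic interval at its right end. Distributing
  it over the halves moves mass to the left, so the values increase with \<open>d\<close> and
  converge.\<close>

fun approx :: "nat \<Rightarrow> nat \<Rightarrow> nat \<Rightarrow> real \<Rightarrow> real" where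
  "approx 0 p m x = (if 1 \<le> x then 1 else 0)"
| "approx (Suc d) p m x = (if x < 1/2 then (1 - rho p m) * approx d p (Suc m) (2 * x)
     else (1 - rho p m) + rho p m * approx d (Suc p) (Suc m) (2 * x - 1))"

lemma approx_bounds: "0 \<le> approx d p m x \<and> approx d p m x \<le> 1"
proof (induction d arbitrary: p m x)
  case (Suc d)
  have "(1 - rho p m) * approx d p (Suc m) (2 * x) \<le> 1 * 1"
    using rho[of p m] Suc by (intro mult_mono) auto
  moreover have "rho p m * approx d (Suc p) (Suc m) (2 * x - 1) \<le> rho p m * 1"
    using rho[of p m] Suc by (intro mult_left_mono) auto
  ultimately show ?case using rho[of p m] Suc by auto
qed simp

lemma approx_le_0: "x \<le> 0 \<Longrightarrow> approx d p m x = 0"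
  by (induction d arbitrary: p m x) auto

lemma approx_ge_1: "1 \<le> x \<Longrightarrow> approx d p m x = 1"
  by (induction d arbitrary: p m x) auto

lemma approx_Suc: "approx d p m x \<le> approx (Suc d) p m x"
proof (induction d arbitrary: p m x)
  case 0
  then show ?case using approx_bounds[of "Suc 0" p m x] approx_ge_1[of x "Suc 0" p m] by (simp del: approx.simps(2))
next
  case (Suc d)
  have "(1 - rho p m) * approx d p (Suc m) (2 * x) \<le> (1 - rho p m) * approx (Suc d) p (Suc m) (2 * x)"
    using rho[of p m] by (intro mult_left_mono Suc) auto
  moreover have "rho p m * approx d (Suc p) (Suc m) (2 * x - 1) \<le> rho p m * approx (Suc d) (Suc p) (Suc m) (2 * x - 1)"
    using rho[of p m] by (intro mult_left_mono Suc) auto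
  ultimately show ?case
    unfolding approx.simps(2)[of "Suc d" p m x] approx.simps(2)[of d p m x] by auto
qed

section \<open>The limit: self-similarity, strict monotonicity, surjectivity\<close>

definition L :: "nat \<Rightarrow> nat \<Rightarrow> real \<Rightarrow> real" where
  "L p m x = lim (\<lambda>d. approx d p m x)"

lemma approx_tendsto: "(\<lambda>d. approx d p m x) \<longlonglongrightarrow> L p m x"
proof -
  have "incseq (\<lambda>d. approx d p m x)" by (intro incseq_SucI approx_Suc)
  then have "convergent (\<lambda>d. approx d p m x)"
    using approx_bounds incseq_convergent[of "\<lambda>d. approx d p m x" 1] by (metis convergentI)
  then show ?thesis by (simp add: L_def convergent_LIMSEQ_iff)
qed

lemma L_bounds: "0 \<le> L p m x" "L p m x \<le> 1"
  using LIMSEQ_le_const[OF approx_tendsto] LIMSEQ_le_const2[OF approx_tendsto] approx_bounds by blast+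

lemma L_0: "L p m 0 = 0" and L_1: "L p m 1 = 1"
  by (simp_all add: L_def approx_le_0 approx_ge_1)

lemma L_right: assumes "1/2 \<le> x"
  shows "L p m x = (1 - rho p m) + rho p m * L (Suc p) (Suc m) (2 * x - 1)"
proof (rule LIMSEQ_unique)
  show "(\<lambda>d. approx (Suc d) p m x) \<longlonglongrightarrow> L p m x"
    by (rule LIMSEQ_Suc[OF approx_tendsto])
  have "(\<lambda>d. (1 - rho p m) + rho p m * approx d (Suc p) (Suc m) (2 * x - 1)) \<longlonglongrightarrow>
      (1 - rho p m) + rho p m * L (Suc p) (Suc m) (2 * x - 1)"
    by (intro tendsto_intros approx_tendsto)
  then show "(\<lambda>d. approx (Suc d) p m x) \<longlonglongrightarrow> (1 - rho p m) + rho p m * L (Suc p) (Suc m) (2 * x - 1)"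
    using assms by simp
qed

lemma L_left: assumes "x \<le> 1/2"
  shows "L p m x = (1 - rho p m) * L p (Suc m) (2 * x)"
proof (cases "x = 1/2")
  \<comment> \<open>At the midpoint the recursion of \<open>approx\<close> takes the right branch;
    both formulas agree there.\<close>
  case True
  then have "2 * x - 1 = 0" "2 * x = 1" by simp_all
  then show ?thesis using L_right[of x p m] True by (simp only: L_0 L_1) simp
next
  case False
  show ?thesis
  proof (rule LIMSEQ_unique)
    show "(\<lambda>d. approx (Suc d) p m x) \<longlonglongrightarrow> L p m x"
      by (rule LIMSEQ_Suc[OF approx_tendsto])
    have "(\<lambda>d. (1 - rho p m) * approx d p (Suc m) (2 * x)) \<longlonglongrightarrow> (1 - rho p m) * L p (Suc m) (2 * x)"
      by (intro tendsto_intros approx_tendsto)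
    then show "(\<lambda>d. approx (Suc d) p m x) \<longlonglongrightarrow> (1 - rho p m) * L p (Suc m) (2 * x)"
      using assms False by simp
  qed
qed

lemma L_less_1: "1 \<le> 2 ^ d * (1 - x) \<Longrightarrow> 0 \<le> x \<Longrightarrow> L p m x < 1"
proof (induction d arbitrary: p m x)
  case 0
  then have "x = 0" by simp
  then show ?case by (simp add: L_0)
next
  case (Suc d)
  show ?case
  proof (cases "x \<le> 1/2")
    case True
    have "L p m x \<le> (1 - rho p m) * 1"
      unfolding L_left[OF True, of p m] using rho[of p m] by (intro mult_left_mono L_bounds) auto
    then have "L p m x \<le> 1 - rho p m" by (simp only: mult_1_right)
    then show ?thesis using rho(1)[of p m] by linarith
  next
    case False
    then have "L (Suc p) (Suc m) (2 * x - 1) < 1"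
      using Suc.prems by (intro Suc.IH) (auto simp: algebra_simps)
    then have "rho p m * L (Suc p) (Suc m) (2 * x - 1) < rho p m * 1"
      using rho[of p m] by (intro mult_strict_left_mono) auto
    then show ?thesis using L_right[of x p m] False by simp
  qed
qed

text \<open>Zooming into the half that contains both points doubles their distance, so after at most
  \<open>d\<close> steps they are separated by a midpoint or are the two ends.\<close>

lemma L_strict_mono_aux:
  "1 \<le> 2 ^ d * (y - x) \<Longrightarrow> 0 \<le> x \<Longrightarrow> x < y \<Longrightarrow> y \<le> 1 \<Longrightarrow> L p m x < L p m y"
proof (induction d arbitrary: p m x y)
  case 0
  then have "x = 0" "y = 1" by auto
  then show ?case by (simp add: L_0 L_1)
next
  case (Suc d)
  consider "y \<le> 1/2" | "1/2 \<le> x" | "x < 1/2" "1/2 < y" by linarith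
  then show ?case
  proof cases
    case 1
    then have "L p (Suc m) (2 * x) < L p (Suc m) (2 * y)"
      using Suc.prems by (intro Suc.IH) (auto simp: algebra_simps)
    then show ?thesis using L_left[of x p m] L_left[of y p m] rho[of p m] Suc.prems 1 by simp
  next
    case 2
    then have "L (Suc p) (Suc m) (2 * x - 1) < L (Suc p) (Suc m) (2 * y - 1)"
      using Suc.prems by (intro Suc.IH) (auto simp: algebra_simps)
    then show ?thesis using L_right[of x p m] L_right[of y p m] rho[of p m] Suc.prems 2 by simp
  next
    \<comment> \<open>The value at the midpoint is \<open>1 - rho p m\<close>; \<open>x\<close>
      stays strictly below it because \<open>L p (Suc m) (2 * x) < 1\<close>.\<close>
    case 3
    obtain e where "1 \<le> 2 ^ e * (1 - 2 * x)" using ex_pow2_mult_ge_1[of "1 - 2 * x"] 3 by auto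
    then have "L p (Suc m) (2 * x) < 1" using Suc.prems by (intro L_less_1[of e]) auto
    then have "(1 - rho p m) * L p (Suc m) (2 * x) < (1 - rho p m) * 1"
      using rho[of p m] by (intro mult_strict_left_mono) auto
    moreover have "0 \<le> rho p m * L (Suc p) (Suc m) (2 * y - 1)"
      using rho[of p m] L_bounds by simp
    ultimately show ?thesis using L_left[of x p m] L_right[of y p m] 3 by simp
  qed
qed

lemma L_strict_mono: "0 \<le> x \<Longrightarrow> x < y \<Longrightarrow> y \<le> 1 \<Longrightarrow> L p m x < L p m y"
  using ex_pow2_mult_ge_1[of "y - x"] L_strict_mono_aux by auto

text \<open>As long as the level is below \<open>\<phi> p\<close>, passing to the left half loses
  only the fraction \<open>\<tau> p\<close> of the mass, and \<open>j\<close> such losses add up to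
  at most \<open>j * \<tau> p\<close>.\<close>

lemma L_gap: "m + j \<le> \<phi> p \<Longrightarrow> 1 - L p m (1 / 2 ^ j) \<le> real j * \<tau> p"
proof (induction j arbitrary: m)
  case 0
  then show ?case by (simp add: L_1)
next
  case (Suc j)
  have "(1::real) \<le> 2 ^ j" by simp
  then have "(1::real) / 2 ^ Suc j \<le> 1/2" by (simp add: field_simps)
  from L_left[OF this, of p m]
  have eq: "L p m (1 / 2 ^ Suc j) = (1 - \<tau> p) * L p (Suc m) (1 / 2 ^ j)"
    using Suc.prems by (simp add: rho_def)
  have IH: "1 - L p (Suc m) (1 / 2 ^ j) \<le> real j * \<tau> p" using Suc by simp
  have "\<tau> p * L p (Suc m) (1 / 2 ^ j) \<le> \<tau> p * 1"
    using \<tau>[of p] by (intro mult_left_mono L_bounds) auto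
  with IH show ?case unfolding eq by (simp add: algebra_simps)
qed

text \<open>A digit one, and any digit at a level \<open>m \<ge> \<phi> p\<close>, halves the image; after \<open>\<phi> (p + q) + q\<close>
  digits either \<open>q\<close> ones or \<open>q\<close> halving levels have occurred.\<close>

lemma L_bracket:
  "\<phi> (p + q) - m + q \<le> d \<Longrightarrow> 0 \<le> v \<Longrightarrow> v \<le> 1 \<Longrightarrow>
    \<exists>x y. 0 \<le> x \<and> x \<le> y \<and> y \<le> 1 \<and> L p m x \<le> v \<and> v \<le> L p m y \<and> L p m y - L p m x \<le> (1/2) ^ q"
proof (induction d arbitrary: p m q v)
  case 0
  then show ?case by (intro exI[of _ 0] exI[of _ 1]) (auto simp: L_0 L_1)
next
  case (Suc d)
  show ?case
  proof (cases q)
    case 0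
    then show ?thesis using Suc.prems by (intro exI[of _ 0] exI[of _ 1]) (auto simp: L_0 L_1)
  next
    case (Suc q')
    have r: "0 < rho p m" "rho p m \<le> 1/2" by (rule rho)+
    show ?thesis
    proof (cases "v \<le> 1 - rho p m")
      case True
      let ?v = "v / (1 - rho p m)"
      have v: "0 \<le> ?v" "?v \<le> 1" using True r Suc.prems by auto
      \<comment> \<open>Digit zero. If the level is halving, \<open>q - 1\<close> further halvings
        suffice; otherwise \<open>m < \<phi> p \<le> \<phi> (p + q)\<close>, so the truncated
        difference drops by one and \<open>q\<close> is kept.\<close>
      obtain k where k: "\<phi> (p + k) - Suc m + k \<le> d" "(1 - rho p m) * (1/2) ^ k \<le> (1/2) ^ q"
      proof (cases "\<phi> p \<le> m")
        case True
        have "\<phi> (p + q') \<le> \<phi> (p + q)" using mono_\<phi> Suc by (auto simp: mono_def)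
        then have "\<phi> (p + q') - Suc m + q' \<le> d" using Suc.prems(1) Suc by linarith
        moreover have "(1 - rho p m) * (1/2) ^ q' \<le> (1/2) ^ q" using True Suc by (simp add: rho_def)
        ultimately show thesis by (rule that)
      next
        case False
        have "\<phi> p \<le> \<phi> (p + q)" using mono_\<phi> by (auto simp: mono_def)
        then have "\<phi> (p + q) - Suc m + q \<le> d" using Suc.prems(1) False by linarith
        moreover have "(1 - rho p m) * (1/2) ^ q \<le> 1 * (1/2) ^ q" using r by (intro mult_right_mono) auto
        ultimately show thesis by (intro that[of q]) auto
      qed
      from Suc.IH[OF k(1) v] obtain x y where xy: "0 \<le> x" "x \<le> y" "y \<le> 1"
        "L p (Suc m) x \<le> ?v" "?v \<le> L p (Suc m) y" "L p (Suc m) y - L p (Suc m) x \<le> (1/2) ^ k" by blast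
      have Lx: "L p m (x/2) = (1 - rho p m) * L p (Suc m) x" and Ly: "L p m (y/2) = (1 - rho p m) * L p (Suc m) y"
        using L_left[of "x/2" p m] L_left[of "y/2" p m] xy by auto
      have "(1 - rho p m) * L p (Suc m) x \<le> (1 - rho p m) * ?v" "(1 - rho p m) * ?v \<le> (1 - rho p m) * L p (Suc m) y"
           "(1 - rho p m) * (L p (Suc m) y - L p (Suc m) x) \<le> (1 - rho p m) * (1/2) ^ k"
        by (intro mult_left_mono xy; use r in simp)+
      moreover have "(1 - rho p m) * ?v = v" using r by simp
      ultimately have "L p m (x/2) \<le> v" "v \<le> L p m (y/2)" "L p m (y/2) - L p m (x/2) \<le> (1/2) ^ q"
        using k(2) unfolding Lx Ly by (auto simp: algebra_simps)
      with xy show ?thesis by (intro exI[of _ "x/2"] exI[of _ "y/2"]) auto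
    next
      case False
      \<comment> \<open>Digit one: the weight \<open>rho p m \<le> 1/2\<close> is itself a halving,
        and a one passes from \<open>q\<close> to \<open>p\<close>, leaving \<open>p + q\<close>
        unchanged.\<close>
      let ?v = "(v - (1 - rho p m)) / rho p m"
      have v: "0 \<le> ?v" "?v \<le> 1" using False r Suc.prems by auto
      have "\<phi> (Suc p + q') - Suc m + q' \<le> d" using Suc.prems(1) Suc by simp
      from Suc.IH[OF this v] obtain x y where xy: "0 \<le> x" "x \<le> y" "y \<le> 1"
        "L (Suc p) (Suc m) x \<le> ?v" "?v \<le> L (Suc p) (Suc m) y"
        "L (Suc p) (Suc m) y - L (Suc p) (Suc m) x \<le> (1/2) ^ q'" by blast
      have Lx: "L p m ((x + 1) / 2) = (1 - rho p m) + rho p m * L (Suc p) (Suc m) x"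
        and Ly: "L p m ((y + 1) / 2) = (1 - rho p m) + rho p m * L (Suc p) (Suc m) y"
      proof -
        have "2 * ((x + 1) / 2) - 1 = x" "2 * ((y + 1) / 2) - 1 = y" by (simp_all add: field_simps)
        then show "L p m ((x + 1) / 2) = (1 - rho p m) + rho p m * L (Suc p) (Suc m) x"
          "L p m ((y + 1) / 2) = (1 - rho p m) + rho p m * L (Suc p) (Suc m) y"
          using L_right[of "(x + 1) / 2" p m] L_right[of "(y + 1) / 2" p m] xy by simp_all
      qed
      have "rho p m * L (Suc p) (Suc m) x \<le> rho p m * ?v" "rho p m * ?v \<le> rho p m * L (Suc p) (Suc m) y"
        by (intro mult_left_mono xy; use r in simp)+
      moreover have "rho p m * (L (Suc p) (Suc m) y - L (Suc p) (Suc m) x) \<le> 1/2 * (1/2) ^ q'"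
        by (intro mult_mono xy r) (use L_bounds xy in auto)
      moreover have "rho p m * ?v = v - (1 - rho p m)" using r by simp
      ultimately have "L p m ((x + 1) / 2) \<le> v" "v \<le> L p m ((y + 1) / 2)"
          "L p m ((y + 1) / 2) - L p m ((x + 1) / 2) \<le> (1/2) ^ q"
        using Suc unfolding Lx Ly by (auto simp: algebra_simps)
      with xy show ?thesis by (intro exI[of _ "(x + 1) / 2"] exI[of _ "(y + 1) / 2"]) auto
    qed
  qed
qed

text \<open>A strictly increasing function can omit \<open>v\<close> only by a jump at the supremum
  \<open>s\<close>, and there are brackets around \<open>v\<close> with arbitrarily close
  values.\<close>

lemma L_surj:
  assumes "0 \<le> v" "v \<le> 1" shows "\<exists>x. 0 \<le> x \<and> x \<le> 1 \<and> L 0 0 x = v"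
proof -
  define A where "A = {x. 0 \<le> x \<and> x \<le> 1 \<and> L 0 0 x \<le> v}"
  have A: "0 \<in> A" "bdd_above A" using assms by (auto simp: A_def L_0)
  define s where "s = Sup A"
  have s: "0 \<le> s" "s \<le> 1"
  proof -
    show "0 \<le> s" unfolding s_def by (rule cSup_upper[OF A])
    show "s \<le> 1" unfolding s_def
    proof (rule cSup_least)
      show "A \<noteq> {}" using A by blast
    qed (simp add: A_def)
  qed
  have bracket: "\<exists>x y. 0 \<le> x \<and> x \<le> y \<and> y \<le> 1 \<and> L 0 0 x \<le> v \<and> v \<le> L 0 0 y \<and> L 0 0 y - L 0 0 x < e"
    if e: "0 < e" for e
  proof -
    obtain q where q: "(1/2::real) ^ q < e" using real_arch_pow_inv[OF e, of "1/2"] by auto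
    have "\<phi> (0 + q) - 0 + q \<le> \<phi> q + q" by simp
    from L_bracket[OF this assms] q show ?thesis by (meson le_less_trans)
  qed
  have "\<not> L 0 0 s < v"
  proof
    assume "L 0 0 s < v"
    then obtain x y where xy: "0 \<le> x" "x \<le> y" "y \<le> 1" "L 0 0 x \<le> v" "v \<le> L 0 0 y" "L 0 0 y - L 0 0 x < v - L 0 0 s"
      using bracket[of "v - L 0 0 s"] by auto
    then have "x \<in> A" by (auto simp: A_def)
    then have "x \<le> s" unfolding s_def by (rule cSup_upper) (rule A)
    then have "L 0 0 x \<le> L 0 0 s" using L_strict_mono[of x s 0 0] xy s by (cases "x = s") auto
    with xy show False by simp
  qed
  moreover have "\<not> v < L 0 0 s"
  proof
    assume "v < L 0 0 s"
    then obtain x y where xy: "0 \<le> x" "x \<le> y" "y \<le> 1" "L 0 0 x \<le> v" "v \<le> L 0 0 y" "L 0 0 y - L 0 0 x < L 0 0 s - v"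
      using bracket[of "L 0 0 s - v"] by auto
    have "y < s"
    proof (rule ccontr)
      assume "\<not> y < s"
      then have "L 0 0 s \<le> L 0 0 y" using L_strict_mono[of s y 0 0] xy s by (cases "s = y") auto
      with xy show False by simp
    qed
    moreover have "s \<le> y" unfolding s_def
    proof (rule cSup_least)
      fix z assume z: "z \<in> A"
      show "z \<le> y"
      proof (rule ccontr)
        assume "\<not> z \<le> y"
        then have "L 0 0 y < L 0 0 z" using L_strict_mono[of y z 0 0] xy z by (auto simp: A_def)
        with z xy show False by (auto simp: A_def)
      qed
    qed (use A in blast)
    ultimately show False by simp
  qed
  ultimately show ?thesis using s by (intro exI[of _ s]) auto
qed

lemma cascade_bijection:
  "\<exists>h. incr_bij h \<and> fixes_off 0 1 h \<and> (\<forall>x\<in>{0..1}. h x = L 0 0 x)"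
proof -
  define h where "h = (\<lambda>x. if x \<in> {0..1} then L 0 0 x else x)"
  have "h x < h y" if "x < y" for x y
    using that L_strict_mono[of x y 0 0] L_bounds[of 0 0 x] L_bounds[of 0 0 y]
    by (auto simp: h_def)
  moreover have "\<exists>x. h x = v" for v
  proof (cases "v \<in> {0..1}")
    case True
    then obtain x where "0 \<le> x" "x \<le> 1" "L 0 0 x = v" using L_surj[of v] by auto
    then show ?thesis by (intro exI[of _ x]) (simp add: h_def)
  next
    case False
    then show ?thesis by (intro exI[of _ v]) (auto simp: h_def)
  qed
  ultimately have "incr_bij h"
    unfolding incr_bij_def strict_mono_def surj_def by metis
  moreover have "fixes_off 0 1 h"
    unfolding fixes_off_def
  proof (intro allI impI)
    fix u :: real assume "u \<le> 0 \<or> 1 \<le> u"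
    then show "h u = u" by (cases "u = 0"; cases "u = 1") (auto simp: h_def L_0 L_1)
  qed
  ultimately show ?thesis by (intro exI[of _ h]) (simp add: h_def)
qed

end

section \<open>Sums over intervals with few binary ones\<close>

context equivariant_arc
begin

text \<open>The expression is \<open>i x - i y\<close> conjugated by \<open>i 1\<close>. It is 0 on
  the diagonal, and on the compact set where it leaves \<open>W\<close>, if nonempty, the distance
  of \<open>x\<close> and \<open>y\<close> has a positive minimum.\<close>

lemma uniform_gap:
  assumes "open W" "0 \<in> W"
  obtains \<delta> where "\<delta> > 0"
    "\<And>x y. x \<in> {0..1} \<Longrightarrow> y \<in> {0..1} \<Longrightarrow> \<bar>x - y\<bar> \<le> \<delta> \<Longrightarrow> - i 1 + i x + (- i y + i 1) \<in> W"
proof -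
  define f where "f = (\<lambda>p. - i 1 + i (fst p) + (- i (snd p) + i 1))"
  let ?S = "{0..1::real} \<times> {0..1::real}"
  have "continuous_on ?S (\<lambda>p. i (fst p))" "continuous_on ?S (\<lambda>p. i (snd p))"
    by (auto intro!: continuous_on_compose2[OF cont_i] continuous_intros)
  then have "continuous_on ?S f"
    unfolding f_def by (intro continuous_intros)
  then have "openin (top_of_set ?S) (?S \<inter> f -` W)"
    using assms(1) by (rule continuous_openin_preimage_gen)
  then have "closedin (top_of_set ?S) (?S - (?S \<inter> f -` W))"
    by (simp add: closedin_diff)
  moreover have "?S - (?S \<inter> f -` W) = ?S - f -` W" by blast
  ultimately have "closedin (top_of_set ?S) (?S - f -` W)" by (simp only:)
  then have K: "compact (?S - f -` W)"
    by (rule closedin_compact[rotated]) (intro compact_Times compact_Icc)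
  show thesis
  proof (cases "?S - f -` W = {}")
    case True
    then have "- i 1 + i x + (- i y + i 1) \<in> W" if "x \<in> {0..1}" "y \<in> {0..1}" for x y
    proof -
      have "f (x, y) \<in> W" using True that by blast
      then show ?thesis by (simp only: f_def fst_conv snd_conv)
    qed
    then show thesis by (intro that[of 1]) auto
  next
    case False
    have "continuous_on (?S - f -` W) (\<lambda>p. \<bar>fst p - snd p\<bar>)" by (intro continuous_intros)
    from continuous_attains_inf[OF K False this] obtain q where
      q: "q \<in> ?S - f -` W" "\<And>p. p \<in> ?S - f -` W \<Longrightarrow> \<bar>fst q - snd q\<bar> \<le> \<bar>fst p - snd p\<bar>" by blast
    have "fst q \<noteq> snd q"
    proof
      assume "fst q = snd q"
      then have "f q = 0" unfolding f_def by (simp only: add.assoc add_minus_cancel left_minus)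
      with q assms show False by simp
    qed
    define r where "r = \<bar>fst q - snd q\<bar>"
    have "0 < r" unfolding r_def using \<open>fst q \<noteq> snd q\<close> by simp
    show thesis
    proof (intro that[of "r / 2"])
      fix x y :: real assume xy: "x \<in> {0..1}" "y \<in> {0..1}" "\<bar>x - y\<bar> \<le> r / 2"
      with \<open>0 < r\<close> have "\<not> r \<le> \<bar>x - y\<bar>" by linarith
      then have "(x, y) \<notin> ?S - f -` W" using q(2)[of "(x, y)"] by (auto simp: r_def)
      then show "- i 1 + i x + (- i y + i 1) \<in> W" using xy by (simp add: f_def)
    qed (use \<open>0 < r\<close> in simp)
  qed
qed

text \<open>Kept pairs telescope, and a skipped interval contributes a conjugated error controlled
  by \<open>uniform_gap\<close>. As the errors accumulate, \<delta> depends on the number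
  \<open>N\<close> of steps.\<close>

lemma psum_near_piece:
  assumes "open W" "0 \<in> W"
  shows "\<exists>\<delta>>0. \<forall>a g. 0 \<le> a \<longrightarrow> psum i \<delta> N a 1 g \<longrightarrow> - (- i a + i 1) + g \<in> W"
  using assms
proof (induction N arbitrary: W)
  case 0
  have "- (- i a + i 1) + g \<in> W" if "psum i 1 0 a 1 g" for a g
    using that 0 by (cases rule: psum.cases) simp
  then show ?case by (intro exI[of _ 1]) auto
next
  case (Suc N)
  obtain V where V: "open V" "0 \<in> V" "\<forall>x\<in>V. \<forall>y\<in>V. x + y \<in> W"
    using nhds_zero_half[OF Suc.prems] by blast
  obtain d where d: "d > 0" "\<forall>a g. 0 \<le> a \<longrightarrow> psum i d N a 1 g \<longrightarrow> - (- i a + i 1) + g \<in> V"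
    using Suc.IH[OF V(1,2)] by blast
  obtain e where e: "e > 0" "\<And>x y. x \<in> {0..1} \<Longrightarrow> y \<in> {0..1} \<Longrightarrow> \<bar>x - y\<bar> \<le> e \<Longrightarrow> - i 1 + i x + (- i y + i 1) \<in> V"
    using uniform_gap[OF V(1,2)] by blast
  have VW: "x \<in> W" if "x \<in> V" for x using V that by (metis add_0)
  have "- (- i a + i 1) + g \<in> W" if a: "0 \<le> a" and g: "psum i (min d e) (Suc N) a 1 g" for a g
    using g
  proof (cases rule: psum.cases)
    case (full m g')
    have "psum i d N m 1 g'" using full(3) by (rule psum_mono_gap) simp
    then have "- (- i m + i 1) + g' \<in> W" using d(2) full(2) a VW by auto
    moreover have "- (- i a + i 1) + g = - (- i m + i 1) + g'"
      unfolding full(1) by (simp only: minus_add minus_minus add.assoc add_minus_cancel)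
    ultimately show ?thesis by simp
  next
    case (gap m)
    have "psum i d N m 1 g" using gap(3) by (rule psum_mono_gap) simp
    then have 1: "- (- i m + i 1) + g \<in> V" using d(2) gap(1) a by auto
    have 2: "- i 1 + i a + (- i m + i 1) \<in> V"
      by (rule e(2)) (use gap a psum_le[OF gap(3)] in auto)
    have "(- i 1 + i a + (- i m + i 1)) + (- (- i m + i 1) + g) \<in> W"
      using V(3) 1 2 by blast
    then show ?thesis
      by (simp only: minus_add minus_minus add.assoc add_minus_cancel minus_add_cancel)
  qed
  with d(1) e(1) show ?case by (intro exI[of _ "min d e"]) auto
qed

text \<open>For \<open>t \<ge> l / 2 ^ j\<close>, \<open>dsum j n a l t\<close> is the sum over the intervals \<open>[q, q + t]\<close>, where \<open>q\<close> runs
  through the points of \<open>[a, a + l]\<close> at which \<open>(q - a) / l\<close> is dyadic with at most \<open>n\<close> binary ones.\<close>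

fun dsum :: "nat \<Rightarrow> nat \<Rightarrow> real \<Rightarrow> real \<Rightarrow> real \<Rightarrow> 'g" where
  "dsum j 0 a l t = - i a + i (a + min t l)"
| "dsum 0 (Suc n) a l t = - i a + i (a + l)"
| "dsum (Suc j) (Suc n) a l t = dsum j (Suc n) a (l/2) t + dsum j n (a + l/2) (l/2) t"

text \<open>Cells of level \<open>j\<close> have length at most \<open>t\<close> and are covered
  entirely; halving one replaces its increment by two that telescope.\<close>

lemma dsum_Suc:
  "0 \<le> l \<Longrightarrow> l \<le> 2 ^ j * t \<Longrightarrow> dsum (Suc j) n a l t = dsum j n a l t"
proof (induction j arbitrary: n a l)
  case 0
  then have "min t (l/2) = l/2" by (simp add: min_def)
  then have "dsum 0 k (a + l/2) (l/2) t = - i (a + l/2) + i (a + l)" for k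
    by (cases k) (simp_all add: add.assoc)
  then show ?case by (cases n) (simp_all only: dsum.simps add.assoc add_minus_cancel)
next
  case (Suc j)
  have "dsum (Suc j) k b (l/2) t = dsum j k b (l/2) t" for k b
    using Suc.prems by (intro Suc.IH) auto
  then show ?case by (cases n) (simp_all only: dsum.simps(1) dsum.simps(3)[of "Suc j"] dsum.simps(3)[of j _ a l])
qed

lemma dsum_indep:
  assumes "0 \<le> l" "l \<le> 2 ^ j * t" "j \<le> k" shows "dsum k n a l t = dsum j n a l t"
  using assms(3)
proof (induction rule: dec_induct)
  case (step k)
  have "0 \<le> t" using assms(1,2) by (meson less_le_trans linorder_not_le mult_pos_neg order.trans zero_less_numeral zero_less_power)
  then have "2 ^ j * t \<le> 2 ^ k * t" using step by (intro mult_right_mono power_increasing) auto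
  then show ?case using dsum_Suc[of l k t n a] step assms by simp
qed simp

lemma dsum_supported:
  "0 \<le> a \<Longrightarrow> 0 \<le> l \<Longrightarrow> a + l \<le> 1 \<Longrightarrow> 0 \<le> t \<Longrightarrow> supported 0 1 (dsum j n a l t)"
proof (induction j n a l t rule: dsum.induct)
  case (3 j n a l t)
  then show ?case unfolding dsum.simps by (intro supported_add "3.IH") auto
next
  case (1 j a l t)
  then show ?case unfolding dsum.simps by (intro supported_piece) auto
next
  case (2 n a l t)
  then show ?case unfolding dsum.simps by (intro supported_piece) auto
qed

lemma dsum_continuous:
  "0 \<le> a \<Longrightarrow> 0 \<le> l \<Longrightarrow> a + l \<le> 1 \<Longrightarrow> continuous_on {0..1} (dsum j n a l)"
proof (induction j arbitrary: n a l)
  case 0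
  then show ?case
    by (cases n) (auto intro!: continuous_intros continuous_on_compose2[OF cont_i] simp del: add_uminus_conv_diff simp: add.commute)
next
  case (Suc j)
  show ?case
  proof (cases n)
    case 0
    then show ?thesis using Suc.prems
      by (auto intro!: continuous_intros continuous_on_compose2[OF cont_i])
  next
    case (Suc k)
    have "continuous_on {0..1} (\<lambda>t. dsum j n a (l/2) t + dsum j k (a + l/2) (l/2) t)"
      using Suc.prems by (intro continuous_on_add Suc.IH) auto
    then show ?thesis unfolding \<open>n = Suc k\<close> by (simp cong: continuous_on_cong)
  qed
qed

lemma psum_piece: "a \<le> m \<Longrightarrow> psum i \<delta> 1 a m (- i a + i m)"
  using psum.full[OF _ psum.nil[of i \<delta> m], of a] by simp

lemma psum_piece_gap: "a \<le> m \<Longrightarrow> m \<le> b \<Longrightarrow> b - m \<le> \<delta> \<Longrightarrow> psum i \<delta> 2 a b (- i a + i m)"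
  using psum.full[OF _ psum.gap[OF _ _ psum.nil[of i \<delta> b], of m], of a] by (simp add: numeral_2_eq_2)

lemma psum_two: assumes "psum i \<delta> (2 * 2 ^ j) a m x" "psum i \<delta> (2 * 2 ^ j) m b y"
  shows "psum i \<delta> (2 * 2 ^ Suc j) a b (x + y)"
  using psum_append[OF assms] by simp

text \<open>Each of the at most \<open>2 ^ j\<close> cells costs at most two steps: a kept interval
  and possibly a skipped rest.\<close>

lemma dsum_psum:
  "0 \<le> a \<Longrightarrow> 0 \<le> l \<Longrightarrow> a + l \<le> 1 \<Longrightarrow> 0 \<le> t \<Longrightarrow> psum i 2 (2 * 2 ^ j) a (a + l) (dsum j n a l t)"
proof (induction j n a l t rule: dsum.induct)
  case (1 j a l t)
  have "psum i 2 2 a (a + l) (dsum j 0 a l t)"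
    unfolding dsum.simps using 1 by (intro psum_piece_gap) auto
  then show ?case by (rule psum_mono_count) simp
next
  case (2 n a l t)
  have "psum i 2 1 a (a + l) (dsum 0 (Suc n) a l t)"
    unfolding dsum.simps using 2 by (intro psum_piece) auto
  then show ?case by (rule psum_mono_count) simp
next
  case (3 j n a l t)
  have "psum i 2 (2 * 2 ^ j) (a + l/2) (a + l/2 + l/2) (dsum j n (a + l/2) (l/2) t)"
    using 3 by (intro "3.IH"(2)) auto
  then have "psum i 2 (2 * 2 ^ j) (a + l/2) (a + l) (dsum j n (a + l/2) (l/2) t)"
    by (simp add: add.assoc)
  moreover have "psum i 2 (2 * 2 ^ j) a (a + l/2) (dsum j (Suc n) a (l/2) t)"
    using 3 by (intro "3.IH"(1)) auto
  ultimately show ?case unfolding dsum.simps by (intro psum_two)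
qed

text \<open>Induction over dyadic cells: \<open>[a, a + l]\<close> has level \<open>m\<close> and
  \<open>p\<close> ones in its address, \<open>n\<close> ones are still allowed, and
  \<open>h\<close> is there a shifted copy of \<open>L p m\<close> of total mass \<kappa>. Gaps
  arise only when the allowance is used up, and then the cascade leaves mass at most
  \<open>\<phi> r * \<tau> r\<close> uncovered.\<close>

lemma dsum_image:
  assumes "cascade \<phi> \<tau>" and h: "incr_bij h" "fixes_off 0 1 h"
    and \<delta>: "real (\<phi> r) * \<tau> r \<le> \<delta>" and j: "p + n = r" "m + j = \<phi> r"
    and hL: "\<And>x. x \<in> {0..1} \<Longrightarrow> h (a + x * l) = c + \<kappa> * cascade.L \<phi> \<tau> p m x"
    and \<kappa>: "0 \<le> \<kappa>" "\<kappa> \<le> 1" and al: "0 \<le> a" "0 < l" "a + l \<le> 1" and t: "l \<le> 2 ^ j * t"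
  shows "psum i \<delta> (2 * 2 ^ j) (h a) (h (a + l)) (E h (dsum j n a l t))"
proof -
  interpret cascade \<phi> \<tau> by fact
  have h2: "fixes_off 0 2 h" using h(2) by (rule fixes_off_mono) auto
  show ?thesis
    using j hL \<kappa> al t
  proof (induction j arbitrary: n p m a l c \<kappa>)
    case 0
    then have t: "min t l = l" by (simp add: min_def)
    have "E h (dsum 0 n a l t) = - i (h a) + i (h (a + l))"
      using 0 t by (cases n) (simp_all only: dsum.simps, auto intro!: E_piece[OF h(1) h2])
    moreover have "psum i \<delta> 1 (h a) (h (a + l)) (- i (h a) + i (h (a + l)))"
      using 0 h by (intro psum_piece) (simp add: incr_bij_le_iff)
    ultimately have "psum i \<delta> 1 (h a) (h (a + l)) (E h (dsum 0 n a l t))" by simp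
    then show ?case by (rule psum_mono_count) simp
  next
    case (Suc j)
    note prems = Suc.prems and IH = Suc.IH
    have t0: "0 < t" using Suc.prems by (meson less_le_trans zero_less_mult_pos zero_less_numeral zero_less_power)
    show ?case
    proof (cases n)
      case 0
      \<comment> \<open>Here \<open>p = r\<close>. The kept piece covers at least the fraction
        \<open>1 / 2 ^ Suc j\<close> of the cell, and \<open>L_gap\<close> bounds the mass of the
        rest.\<close>
      let ?x = "min t l / l"
      have x: "?x \<in> {0..1}" "a + ?x * l = a + min t l" "1 / 2 ^ Suc j \<le> ?x"
      proof -
        show "?x \<in> {0..1}" "a + ?x * l = a + min t l" using Suc.prems t0 by (auto simp: min_def)
        have "(1::real) \<le> 2 ^ Suc j" by (rule one_le_power) simp
        then have "l / 2 ^ Suc j \<le> l / 1" using prems by (intro divide_left_mono) auto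
        moreover have "l / 2 ^ Suc j \<le> t" using prems by (simp add: divide_le_eq mult.commute)
        ultimately have "(l / 2 ^ Suc j) / l \<le> ?x" using prems by (intro divide_right_mono) auto
        then show "1 / 2 ^ Suc j \<le> ?x" using prems by simp
      qed
      have "L p m (1 / 2 ^ Suc j) \<le> L p m ?x"
        using L_strict_mono[of "1 / 2 ^ Suc j" ?x p m] x by (cases "1 / 2 ^ Suc j = ?x") auto
      moreover have "1 - L p m (1 / 2 ^ Suc j) \<le> real (Suc j) * \<tau> p"
        using Suc.prems 0 by (intro L_gap) simp
      moreover have "real (Suc j) * \<tau> p \<le> real (\<phi> r) * \<tau> r"
        using Suc.prems 0 \<tau>[of r] by (intro mult_mono) auto
      ultimately have gap: "1 - L p m ?x \<le> \<delta>" using \<delta> by linarith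
      have "\<kappa> * (1 - L p m ?x) \<le> 1 * (1 - L p m ?x)"
        using L_bounds Suc.prems by (intro mult_right_mono) auto
      moreover have "h (a + l) - h (a + min t l) = \<kappa> * (1 - L p m ?x)"
        using Suc.prems(3)[OF x(1)] Suc.prems(3)[of 1] x(2) L_1 by (simp add: algebra_simps)
      ultimately have "h (a + l) - h (a + min t l) \<le> \<delta>" using gap by simp
      then have "psum i \<delta> 2 (h a) (h (a + l)) (- i (h a) + i (h (a + min t l)))"
        using Suc.prems t0 by (intro psum_piece_gap) (auto simp: incr_bij_le_iff[OF h(1)])
      moreover have "E h (dsum (Suc j) n a l t) = - i (h a) + i (h (a + min t l))"
        unfolding 0 dsum.simps using Suc.prems t0 by (intro E_piece[OF h(1) h2]) auto
      ultimately have "psum i \<delta> 2 (h a) (h (a + l)) (E h (dsum (Suc j) n a l t))" by simp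
      then show ?thesis by (rule psum_mono_count) simp
    next
      case (Suc k)
      have r: "0 < rho p m" "rho p m \<le> 1/2" by (rule rho)+
      \<comment> \<open>The left half keeps \<open>p\<close> and gets the share
        \<open>1 - rho p m\<close>; the right half, treated next, gets \<open>rho p m\<close> and
        uses up one of the allowed ones.\<close>
      have "psum i \<delta> (2 * 2 ^ j) (h a) (h (a + l/2)) (E h (dsum j (Suc k) a (l/2) t))"
      proof (rule IH[where p = p and m = "Suc m" and c = c and \<kappa> = "\<kappa> * (1 - rho p m)"])
        show "h (a + x * (l/2)) = c + \<kappa> * (1 - rho p m) * L p (Suc m) x" if "x \<in> {0..1}" for x
          using prems(3)[of "x/2"] L_left[of "x/2" p m] that by simp
        have "\<kappa> * (1 - rho p m) \<le> 1 * 1" using r prems by (intro mult_mono) auto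
        then show "\<kappa> * (1 - rho p m) \<le> 1" by simp
      qed (use prems Suc r in auto)
      moreover have "psum i \<delta> (2 * 2 ^ j) (h (a + l/2)) (h (a + l/2 + l/2)) (E h (dsum j k (a + l/2) (l/2) t))"
      proof (rule IH[where p = "Suc p" and m = "Suc m" and c = "c + \<kappa> * (1 - rho p m)" and \<kappa> = "\<kappa> * rho p m"])
        show "h (a + l/2 + x * (l/2)) = c + \<kappa> * (1 - rho p m) + \<kappa> * rho p m * L (Suc p) (Suc m) x"
          if "x \<in> {0..1}" for x
        proof -
          have x: "a + l/2 + x * (l/2) = a + (x + 1) / 2 * l" "2 * ((x + 1) / 2) - 1 = x"
            by (simp_all add: field_simps)
          have "L p m ((x + 1) / 2) = (1 - rho p m) + rho p m * L (Suc p) (Suc m) x"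
            using L_right[of "(x + 1) / 2" p m] x(2) that by simp
          moreover have "h (a + (x + 1) / 2 * l) = c + \<kappa> * L p m ((x + 1) / 2)"
            using that by (intro prems(3)) simp
          ultimately show ?thesis unfolding x(1) by (simp add: distrib_left mult.assoc)
        qed
        have "\<kappa> * rho p m \<le> 1 * 1" using r prems by (intro mult_mono) auto
        then show "\<kappa> * rho p m \<le> 1" by simp
      qed (use prems Suc r in auto)
      ultimately show ?thesis
        unfolding Suc dsum.simps E_add[OF h(1) h2] by (intro psum_two) (simp_all add: add.assoc)
    qed
  qed
qed

section \<open>The case of small sums to the right of every point\<close>

text \<open>Continuity of the spines at 0 is proved by induction on the number of ones; away from 0
  each spine is locally one \<open>dsum\<close>. The expanding homeomorphisms are cascades.\<close>

lemma hedgehog_of_small_sums: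
  assumes small: "\<And>p U. 0 \<le> p \<Longrightarrow> p < 1 \<Longrightarrow> open U \<Longrightarrow> 0 \<in> U \<Longrightarrow>
    \<exists>q>p. \<forall>a b N g. p < a \<longrightarrow> b \<le> q \<longrightarrow> psum i 2 N a b g \<longrightarrow> g \<in> U"
  shows "\<exists>S :: 'g set. top_of_set S homeomorphic_space sequential_hedgehog"
proof -
  \<comment> \<open>The hypothesis speaks of sums starting strictly to the right of
    \<open>p\<close>; by continuity of \<open>i\<close> at \<open>p\<close>, a first summand
    starting at \<open>p\<close> itself can be added.\<close>
  have small_at: "\<exists>q>p. \<forall>b N g. b \<le> q \<longrightarrow> psum i 2 N p b g \<longrightarrow> g \<in> U"
    if p: "0 \<le> p" "p < 1" and U: "open U" "0 \<in> U" for p U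
  proof -
    obtain V where V: "open V" "0 \<in> V" "\<forall>x\<in>V. \<forall>y\<in>V. x + y \<in> U"
      using nhds_zero_half[OF U] by blast
    have VU: "x \<in> U" if "x \<in> V" for x using V that by (metis add_0)
    obtain q where q: "p < q" "\<And>a b N g. p < a \<Longrightarrow> b \<le> q \<Longrightarrow> psum i 2 N a b g \<Longrightarrow> g \<in> V"
      using small[OF p V(1,2)] by blast
    obtain d where d: "d > 0" "\<And>y. y \<in> {0..2} \<Longrightarrow> \<bar>y - p\<bar> < d \<Longrightarrow> - i p + i y \<in> V"
      using i_near[of "{z. - i p + z \<in> V}" p] open_left_translation(1)[OF V(1)] V p by auto
    define e where "e = min q (min 2 (p + d / 2))"
    have e: "p < e" "e \<le> q" "e \<le> 2" "e < p + d" using q d p by (auto simp: e_def min_def)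
    have "g \<in> U" if "psum i 2 N a b g" "a = p" "b \<le> e" for N a b g
      using that
    proof (induction rule: psum.induct)
      case (nil a)
      then show ?case using U by simp
    next
      case (full a m N b g)
      show ?case
      proof (cases "a = m")
        case True
        then show ?thesis using full by simp
      next
        case False
        then have "p < m" using full by simp
        then have "g \<in> V" using q(2)[of m b] e full by auto
        moreover have "- i p + i m \<in> V"
          using psum_le[OF full(2)] full.prems full.hyps e p by (intro d(2)) auto
        ultimately show ?thesis using V(3) full.prems(1) by blast
      qed
    next
      case (gap a m N b g)
      show ?case
      proof (cases "a = m")
        case True
        then show ?thesis using gap by simp
      next
        case False
        then have "p < m" using gap by simp
        then show ?thesis using q(2)[of m b] e gap VU by auto
      qed
    qed
    with e(1) show ?thesis by blast
  qed
  have dsum_small: "\<exists>\<theta>>0. \<forall>t j. 0 < t \<and> t < \<theta> \<and> l \<le> 2 ^ j * t \<longrightarrow> dsum j n a l t \<in> U"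
    if "0 \<le> a" "0 < l" "a + l \<le> 1" "open U" "0 \<in> U" for n a l U
    using that
  proof (induction n arbitrary: a l U)
    case 0
    obtain d where d: "d > 0" "\<And>y. y \<in> {0..2} \<Longrightarrow> \<bar>y - a\<bar> < d \<Longrightarrow> - i a + i y \<in> U"
      using i_near[of "{z. - i a + z \<in> U}" a] open_left_translation(1)[OF 0(4)] 0 by auto
    have "dsum j 0 a l t \<in> U" if "0 < t" "t < d" for t j
      unfolding dsum.simps using that 0 by (intro d(2)) (auto simp: min_def)
    with d(1) show ?case by blast
  next
    case (Suc n)
    note a = \<open>0 \<le> a\<close> and l = \<open>0 < l\<close> and al = \<open>a + l \<le> 1\<close>
    \<comment> \<open>Peeling off the right halves at the \<open>k\<close> largest scales, each
      allowing one binary one fewer, leaves the cell \<open>[a, a + l / 2 ^ k]\<close> at the left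
      end.\<close>
    have split: "\<exists>\<theta>>0. \<forall>t j. 0 < t \<and> t < \<theta> \<and> l \<le> 2 ^ j * t \<longrightarrow>
        (\<exists>y\<in>W. \<exists>j'. dsum j (Suc n) a l t = dsum j' (Suc n) a (l / 2 ^ k) t + y \<and> l / 2 ^ k \<le> 2 ^ j' * t)"
      if "open W" "0 \<in> W" for k W
      using that
    proof (induction k arbitrary: W)
      case 0
      then show ?case by (intro exI[of _ 1]) force
    next
      case (Suc k)
      let ?l = "l / 2 ^ k"
      have l': "0 < ?l" "?l \<le> l" using l by (auto simp: field_simps)
      obtain V where V: "open V" "0 \<in> V" "\<forall>x\<in>V. \<forall>y\<in>V. x + y \<in> W"
        using nhds_zero_half[OF Suc.prems] by blast
      obtain \<theta> where \<theta>: "\<theta> > 0" "\<And>t j. 0 < t \<Longrightarrow> t < \<theta> \<Longrightarrow> l \<le> 2 ^ j * t \<Longrightarrow>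
          \<exists>y\<in>V. \<exists>j'. dsum j (Suc n) a l t = dsum j' (Suc n) a ?l t + y \<and> ?l \<le> 2 ^ j' * t"
        using Suc.IH[OF V(1,2)] by blast
      have "0 \<le> a + ?l/2" "0 < ?l/2" "a + ?l/2 + ?l/2 \<le> 1" using a l' al by auto
      from \<open>\<And>a l U. 0 \<le> a \<Longrightarrow> 0 < l \<Longrightarrow> a + l \<le> 1 \<Longrightarrow> open U \<Longrightarrow> 0 \<in> U \<Longrightarrow> 
          \<exists>\<theta>>0. \<forall>t j. 0 < t \<and> t < \<theta> \<and> l \<le> 2 ^ j * t \<longrightarrow> dsum j n a l t \<in> U\<close>[OF this V(1,2)]
      obtain \<eta> where \<eta>: "\<eta> > 0" "\<And>t j. 0 < t \<Longrightarrow> t < \<eta> \<Longrightarrow> ?l/2 \<le> 2 ^ j * t \<Longrightarrow> dsum j n (a + ?l/2) (?l/2) t \<in> V"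
        by blast
      have "\<exists>y\<in>W. \<exists>j'. dsum j (Suc n) a l t = dsum j' (Suc n) a (l / 2 ^ Suc k) t + y \<and> l / 2 ^ Suc k \<le> 2 ^ j' * t"
        if t: "0 < t" "t < min \<theta> (min \<eta> ?l)" "l \<le> 2 ^ j * t" for t j
      proof -
        obtain y j' where y: "y \<in> V" "dsum j (Suc n) a l t = dsum j' (Suc n) a ?l t + y" "?l \<le> 2 ^ j' * t"
          using \<theta>(2)[of t j] t by auto
        \<comment> \<open>Since \<open>t < ?l\<close>, level 0 would be too coarse; hence the
          recursion of \<open>dsum\<close> can be unfolded.\<close>
        have "j' \<noteq> 0" using y(3) t by (intro notI) simp
        then obtain k' where k': "j' = Suc k'" by (cases j') auto
        then have k't: "?l/2 \<le> 2 ^ k' * t" using y(3) by simp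
        have "dsum k' n (a + ?l/2) (?l/2) t \<in> V" using \<eta>(2) t k't by simp
        with y(1) V(3) have "dsum k' n (a + ?l/2) (?l/2) t + y \<in> W" by blast
        moreover have "dsum j (Suc n) a l t = dsum k' (Suc n) a (?l/2) t + (dsum k' n (a + ?l/2) (?l/2) t + y)"
          unfolding y(2) k' dsum.simps add.assoc by (rule refl)
        moreover have "l / 2 ^ Suc k = ?l/2" by simp
        ultimately show ?thesis using k't by metis
      qed
      moreover have "0 < min \<theta> (min \<eta> ?l)" using \<theta> \<eta> l' by simp
      ultimately show ?case by blast
    qed
    obtain V where V: "open V" "0 \<in> V" "\<forall>x\<in>V. \<forall>y\<in>V. x + y \<in> U"
      using nhds_zero_half[OF Suc.prems(4,5)] by blast
    have "a < 1" using l al by simp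
    from small_at[OF a this V(1,2)] obtain q where q: "a < q"
      "\<And>b N g. b \<le> q \<Longrightarrow> psum i 2 N a b g \<Longrightarrow> g \<in> V" by blast
    \<comment> \<open>The remaining cell then fits into the interval in which all sums starting at
      \<open>a\<close> lie in \<open>V\<close>.\<close>
    obtain k where "l / (q - a) < 2 ^ k" using real_arch_pow[of 2 "l / (q - a)"] by auto
    then have k: "l / 2 ^ k \<le> q - a" using q(1) by (simp add: field_simps)
    have lk: "0 \<le> l / 2 ^ k" "l / 2 ^ k \<le> l" using l by (auto simp: field_simps)
    obtain \<theta> where \<theta>: "\<theta> > 0" "\<And>t j. 0 < t \<Longrightarrow> t < \<theta> \<Longrightarrow> l \<le> 2 ^ j * t \<Longrightarrow>
        \<exists>y\<in>V. \<exists>j'. dsum j (Suc n) a l t = dsum j' (Suc n) a (l / 2 ^ k) t + y \<and> l / 2 ^ k \<le> 2 ^ j' * t"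
      using split[OF V(1,2), of k] by blast
    have "dsum j (Suc n) a l t \<in> U" if t: "0 < t" "t < \<theta>" "l \<le> 2 ^ j * t" for t j
    proof -
      obtain y j' where y: "y \<in> V" "dsum j (Suc n) a l t = dsum j' (Suc n) a (l / 2 ^ k) t + y"
        using \<theta>(2)[OF t] by blast
      have "psum i 2 (2 * 2 ^ j') a (a + l / 2 ^ k) (dsum j' (Suc n) a (l / 2 ^ k) t)"
        by (rule dsum_psum) (use a al lk t in auto)
      then have "dsum j' (Suc n) a (l / 2 ^ k) t \<in> V" by (rule q(2)[rotated]) (use k in simp)
      with V(3) y show ?thesis by simp
    qed
    with \<theta>(1) show ?case by blast
  qed
  \<comment> \<open>Any level whose cells have length at most \<open>t\<close> gives the same
    value.\<close>
  define J where "J = (\<lambda>t. SOME j. 1 \<le> 2 ^ j * (t::real))"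
  define \<gamma> where "\<gamma> = (\<lambda>n t. if t \<le> 0 then 0 else dsum (J t) n 0 1 t)"
  have \<gamma>_eq: "\<gamma> n t = dsum j n 0 1 t" if "1 \<le> 2 ^ j * t" for n j t
  proof -
    have J: "1 \<le> 2 ^ J t * t" unfolding J_def using that by (rule someI)
    have "0 < t" using that by (meson less_le_trans zero_less_mult_pos zero_less_numeral zero_less_one zero_less_power)
    moreover have "dsum (J t) n 0 1 t = dsum j n 0 1 t"
      using dsum_indep[OF _ that, of "J t" n 0] dsum_indep[OF _ J, of j n 0] by (cases "j \<le> J t") auto
    ultimately show ?thesis by (simp add: \<gamma>_def)
  qed
  have \<gamma>_0: "\<gamma> n 0 = 0" for n by (simp add: \<gamma>_def)
  have \<gamma>_cont: "continuous_on {0..1} (\<gamma> n)" for n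
    unfolding continuous_on_def
  proof
    fix t0 :: real assume t0: "t0 \<in> {0..1}"
    show "(\<gamma> n \<longlongrightarrow> \<gamma> n t0) (at t0 within {0..1})"
    proof (cases "t0 = 0")
      case True
      show ?thesis unfolding True \<gamma>_0
      proof (rule topological_tendstoI)
        fix U :: "'g set" assume U: "open U" "0 \<in> U"
        obtain \<theta> where \<theta>: "\<theta> > 0" "\<And>t j. 0 < t \<Longrightarrow> t < \<theta> \<Longrightarrow> 1 \<le> 2 ^ j * t \<Longrightarrow> dsum j n 0 1 t \<in> U"
          using dsum_small[of 0 1 U n] U by auto
        have "\<gamma> n t \<in> U" if "t \<in> {0..1}" "t \<noteq> 0" "t < \<theta>" for t
        proof -
          obtain j where "1 \<le> 2 ^ j * t" using ex_pow2_mult_ge_1[of t] \<open>t \<in> {0..1}\<close> \<open>t \<noteq> 0\<close> by auto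
          with \<theta>(2)[of t j] \<gamma>_eq[of j t n] that show ?thesis by auto
        qed
        then show "eventually (\<lambda>t. \<gamma> n t \<in> U) (at 0 within {0..1})"
          using \<theta>(1) unfolding eventually_at by (intro exI[of _ \<theta>]) (auto simp: dist_real_def)
      qed
    next
      case False
      \<comment> \<open>One level serves all \<open>t \<ge> t0 / 2\<close>, hence a neighbourhood of
        \<open>t0\<close>.\<close>
      with t0 obtain j where j: "1 \<le> 2 ^ j * (t0 / 2)" using ex_pow2_mult_ge_1[of "t0 / 2"] by auto
      have "(dsum j n 0 1 \<longlongrightarrow> dsum j n 0 1 t0) (at t0 within {0..1})"
        using dsum_continuous[of 0 1 j n] t0 by (simp add: continuous_on_def)
      moreover have eq: "\<gamma> n t = dsum j n 0 1 t" if "t0 / 2 \<le> t" for t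
      proof (rule \<gamma>_eq)
        have "2 ^ j * (t0 / 2) \<le> 2 ^ j * t" using that by (intro mult_left_mono) auto
        with j show "1 \<le> 2 ^ j * t" by linarith
      qed
      moreover have "eventually (\<lambda>t. dsum j n 0 1 t = \<gamma> n t) (at t0 within {0..1})"
        unfolding eventually_at
      proof (intro exI[of _ "t0 / 2"] conjI ballI impI)
        show "0 < t0 / 2" using t0 False by simp
        show "dsum j n 0 1 t = \<gamma> n t" if "t \<noteq> t0 \<and> dist t t0 < t0 / 2" for t
        proof -
          have "\<bar>t - t0\<bar> < t0 / 2" using that by (simp add: dist_real_def)
          then have "t0 / 2 \<le> t" by linarith
          then show ?thesis using eq by simp
        qed
      qed
      ultimately show ?thesis using t0 eq[of t0] by (simp add: Lim_transform_eventually)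
    qed
  qed
  obtain U where U: "open U" "0 \<in> U" "- i 0 + i 1 \<notin> U"
    using not_insep_i[of 0 1] by (auto simp: insep_def)
  obtain W where W: "open W" "0 \<in> W" "\<forall>x\<in>W. -x \<in> W" "\<forall>x\<in>W. \<forall>y\<in>W. x + y \<in> U"
    using nhds_zero_half[OF U(1,2)] by blast
  show ?thesis
  proof (rule hedgehog_of_core[of \<gamma> W])
    show "supported 0 1 (\<gamma> n t)" if "t \<in> {0..1}" for n t
      unfolding \<gamma>_def using that by (auto intro: supported_zero dsum_supported)
    fix \<epsilon> :: "nat \<Rightarrow> real" assume \<epsilon>: "\<And>n. \<epsilon> n > 0"
    have "\<forall>n. \<exists>c. 1 \<le> 2 ^ c * \<epsilon> n" using ex_pow2_mult_ge_1 \<epsilon> by blast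
    then obtain c where c: "\<And>n. 1 \<le> 2 ^ c n * \<epsilon> n" by metis
    \<comment> \<open>Partial sums make \<phi> monotone while keeping
      \<open>\<phi> n \<ge> c n\<close>, so cells of level \<open>\<phi> n\<close> have length at
      most \<open>\<epsilon> n\<close>.\<close>
    define \<phi> where "\<phi> = (\<lambda>n. \<Sum>k\<le>n. c k)"
    have \<phi>: "1 \<le> 2 ^ \<phi> n * \<epsilon> n" for n
    proof -
      have "c n \<le> \<phi> n" unfolding \<phi>_def by (rule member_le_sum) auto
      then have "2 ^ c n * \<epsilon> n \<le> 2 ^ \<phi> n * \<epsilon> n"
        using \<epsilon>[of n] by (intro mult_right_mono power_increasing) auto
      with c[of n] show ?thesis by linarith
    qed
    \<comment> \<open>The tolerance is fixed after \<open>\<phi> n\<close>, since it depends on the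
      number of steps of a sum of level \<open>\<phi> n\<close>.\<close>
    have "\<forall>n. \<exists>\<delta>>0. \<forall>a g. 0 \<le> a \<longrightarrow> psum i \<delta> (2 * 2 ^ \<phi> n) a 1 g \<longrightarrow> - (- i a + i 1) + g \<in> W"
      using psum_near_piece[OF W(1,2)] by blast
    from choice[OF this] obtain \<delta> where
      "\<forall>n. \<delta> n > 0 \<and> (\<forall>a g. 0 \<le> a \<longrightarrow> psum i (\<delta> n) (2 * 2 ^ \<phi> n) a 1 g \<longrightarrow> - (- i a + i 1) + g \<in> W)" ..
    then have \<delta>: "\<delta> n > 0" "psum i (\<delta> n) (2 * 2 ^ \<phi> n) 0 1 g \<Longrightarrow> - (- i 0 + i 1) + g \<in> W" for n g
      by auto
    \<comment> \<open>Chosen to give \<open>\<phi> n * \<tau> n \<le> \<delta> n\<close>; the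
      \<open>+ 1\<close> avoids division by 0 when \<open>\<phi> n = 0\<close>.\<close>
    define \<tau> where "\<tau> = (\<lambda>n. min (1/2) (\<delta> n / (real (\<phi> n) + 1)))"
    interpret cascade \<phi> \<tau>
    proof
      show "mono \<phi>" unfolding \<phi>_def by (intro monoI sum_mono2) auto
      show "0 < \<tau> p" "\<tau> p \<le> 1/2" for p
      proof -
        show "0 < \<tau> p" using \<delta>(1)[of p] by (simp add: \<tau>_def)
        show "\<tau> p \<le> 1/2" unfolding \<tau>_def by (rule min.cobounded1)
      qed
    qed
    have \<tau>\<delta>: "real (\<phi> n) * \<tau> n \<le> \<delta> n" for n
    proof -
      have "real (\<phi> n) * \<tau> n \<le> (real (\<phi> n) + 1) * (\<delta> n / (real (\<phi> n) + 1))"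
        using \<tau>(1)[of n] by (intro mult_mono) (auto simp: \<tau>_def)
      then show ?thesis by (simp add: add_nonneg_eq_0_iff)
    qed
    obtain h where h: "incr_bij h" "fixes_off 0 1 h" "\<forall>x\<in>{0..1}. h x = L 0 0 x"
      using cascade_bijection by blast
    have "E h (\<gamma> n t) \<notin> W" if t: "\<epsilon> n \<le> t" "t \<le> 1" for n t
    proof
      assume *: "E h (\<gamma> n t) \<in> W"
      have "2 ^ \<phi> n * \<epsilon> n \<le> 2 ^ \<phi> n * t" using t by (intro mult_left_mono) auto
      with \<phi>[of n] have t1: "1 \<le> 2 ^ \<phi> n * t" by linarith
      \<comment> \<open>The root cell: level 0, no ones so far, total mass 1.\<close>
      have "psum i (\<delta> n) (2 * 2 ^ \<phi> n) (h 0) (h (0 + 1)) (E h (dsum (\<phi> n) n 0 1 t))"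
        by (rule dsum_image[OF cascade_axioms h(1,2) \<tau>\<delta>[of n], where p = 0 and m = 0 and c = 0 and \<kappa> = 1])
          (use h(3) t1 in auto)
      moreover have "h 0 = 0" "h (0 + 1) = 1" using h(2) by (auto simp: fixes_off_def)
      ultimately have "- (- i 0 + i 1) + E h (\<gamma> n t) \<in> W"
        using \<delta>(2) \<gamma>_eq[OF t1, of n] by simp
      then have "- (- (- i 0 + i 1) + E h (\<gamma> n t)) \<in> W" using W(3) by blast
      with * W(4) have "E h (\<gamma> n t) + - (- (- i 0 + i 1) + E h (\<gamma> n t)) \<in> U" by blast
      then have "- i 0 + i 1 \<in> U"
        by (simp only: minus_add minus_minus add.assoc add_minus_cancel)
      with U show False by blast
    qed
    with h show "\<exists>h. incr_bij h \<and> fixes_off 0 1 h \<and> (\<forall>n t. \<epsilon> n \<le> t \<and> t \<le> 1 \<longrightarrow> E h (\<gamma> n t) \<notin> W)"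
      by blast
  qed (use \<gamma>_cont \<gamma>_0 W in auto)
qed

lemma sequential_hedgehog_exists: "\<exists>S :: 'g set. top_of_set S homeomorphic_space sequential_hedgehog"
proof (cases "\<forall>p U. 0 \<le> p \<and> p < 1 \<and> open U \<and> 0 \<in> U \<longrightarrow>
    (\<exists>q>p. \<forall>a b N g. p < a \<longrightarrow> b \<le> q \<longrightarrow> psum i 2 N a b g \<longrightarrow> g \<in> U)")
  case True
  then show ?thesis by (intro hedgehog_of_small_sums) simp
next
  case False
  then obtain p U where "0 \<le> p" "p < 1" "open U" "0 \<in> U"
    and "\<not> (\<exists>q>p. \<forall>a b N g. p < a \<longrightarrow> b \<le> q \<longrightarrow> psum i 2 N a b g \<longrightarrow> g \<in> U)" by blast
  then show ?thesis by (intro hedgehog_of_large_sums[of p U]) blast+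
qed

end

section \<open>Functorial embeddings of the unit interval\<close>

lemma autohomeomorphism_of_incr_bij:
  assumes "incr_bij h" "fixes_off 0 2 h"
  shows "(\<lambda>x\<in>{0..1}. h (2 * x) / 2) \<in> autohomeomorphisms (top_of_set {0..1})"
proof -
  have inv: "h (inv h x) = x" "inv h (h x) = x" for x
    using assms(1) by (auto simp: incr_bij_def surj_f_inv_f strict_mono_imp_inj_on inv_f_f)
  have maps: "g (2 * x) / 2 \<in> {0..1}" if "incr_bij g" "fixes_off 0 2 g" "x \<in> {0..1}" for g x
    using fixes_off_maps[OF that(1,2), of "2 * x"] that(3) by simp
  have cmap: "continuous_map (top_of_set {0..1}) (top_of_set {0..1}) (\<lambda>x\<in>{0..1}. g (2 * x) / 2)"
    if "incr_bij g" "fixes_off 0 2 g" for g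
  proof -
    have "continuous_on {0..1} (\<lambda>x. g (2 * x) / 2)"
      by (intro continuous_intros continuous_on_compose2[OF incr_bij_continuous[OF that(1), of UNIV]]) auto
    then have "continuous_on {0..1} (\<lambda>x\<in>{0..1}. g (2 * x) / 2)" by (rule continuous_on_eq) simp
    moreover have "(\<lambda>x\<in>{0..1}. g (2 * x) / 2) \<in> {0..1} \<rightarrow> {0..1}"
      using maps[OF that] by (simp add: Pi_iff)
    ultimately show ?thesis by (simp only: continuous_map_subtopology_eu)
  qed
  have "inv h u = u" if "h u = u" for u using inv(2)[of u] that by simp
  then have g: "incr_bij (inv h)" "fixes_off 0 2 (inv h)"
    using assms incr_bij_inv by (auto simp: fixes_off_def)
  have "homeomorphic_maps (top_of_set {0..1}) (top_of_set {0..1})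
      (\<lambda>x\<in>{0..1}. h (2 * x) / 2) (\<lambda>x\<in>{0..1}. inv h (2 * x) / 2)"
    unfolding homeomorphic_maps_def
  proof (intro conjI cmap assms g ballI)
    fix x assume "x \<in> topspace (top_of_set {0..1::real})"
    then have x: "x \<in> {0..1}" by simp
    show "(\<lambda>x\<in>{0..1}. inv h (2 * x) / 2) ((\<lambda>x\<in>{0..1}. h (2 * x) / 2) x) = x"
      using maps[OF assms x] x by (simp add: inv)
    show "(\<lambda>x\<in>{0..1}. h (2 * x) / 2) ((\<lambda>x\<in>{0..1}. inv h (2 * x) / 2) x) = x"
      using maps[OF g x] x by (simp add: inv)
  qed
  then show ?thesis
    unfolding autohomeomorphisms_def by (auto simp: homeomorphic_map_maps)
qed

text \<open>The image inherits the separation of the domain: \<open>A - {y}\<close> is open in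
  \<open>A\<close>, so some open \<open>T\<close> meets the image exactly in the image of
  \<open>A - {y}\<close>, whereas inseparability from \<open>i x\<close> would put
  \<open>i y\<close> into \<open>T\<close>.\<close>

lemma embedding_not_insep:
  fixes i :: "'x::t1_space \<Rightarrow> 'g::topological_group_add"
  assumes i: "embedding_map (top_of_set A) euclidean i" and xy: "x \<in> A" "y \<in> A" "x \<noteq> y"
  shows "\<not> insep (i x) (i y)"
proof
  assume *: "insep (i x) (i y)"
  have hom: "homeomorphic_map (top_of_set A) (top_of_set (i ` A)) i"
    using i by (simp add: embedding_map_def)
  have "openin (top_of_set A) (A \<inter> - {y})" by (intro openin_open_Int) auto
  then have "openin (top_of_set (i ` A)) (i ` (A \<inter> - {y}))"
    using hom by (simp add: homeomorphic_map_openness_eq)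
  then obtain T where T: "open T" "i ` (A \<inter> - {y}) = i ` A \<inter> T" by (auto simp: openin_open)
  have "i x \<in> T" using T(2) xy by blast
  then have "0 \<in> {z. i x + z \<in> T}" by simp
  with *[unfolded insep_def, rule_format, OF conjI, OF open_left_translation(1)[OF T(1), of "i x"]]
  have "- i x + i y \<in> {z. i x + z \<in> T}" by metis
  then have "i y \<in> T" by (simp add: add.assoc[symmetric])
  then have "i y \<in> i ` (A \<inter> - {y})" using T(2) xy by blast
  moreover have "inj_on i A" using hom by (auto simp: homeomorphic_map_def)
  ultimately show False using xy by (auto dest: inj_onD)
qed

theorem theorem1:
  fixes i :: "real \<Rightarrow> 'g::topological_group_add"
    and F :: "(real \<Rightarrow> real) \<Rightarrow> 'g \<Rightarrow> 'g"
  assumes "functorial_embedding (top_of_set {0..1}) i F"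
  shows "\<exists>S :: 'g set. top_of_set S homeomorphic_space sequential_hedgehog"
proof -
  \<comment> \<open>Conjugation by doubling turns a bijection of \<open>[0, 2]\<close> into one of
    \<open>[0, 1]\<close>, restricted so as to be extensional.\<close>
  let ?c = "\<lambda>h. \<lambda>x\<in>{0..1::real}. h (2 * x) / 2 :: real"
  have emb: "embedding_map (top_of_set {0..1}) euclidean i"
    and Fh: "\<And>h. h \<in> autohomeomorphisms (top_of_set {0..1}) \<Longrightarrow> continuous_on UNIV (F h)"
      "\<And>h a b. h \<in> autohomeomorphisms (top_of_set {0..1}) \<Longrightarrow> F h (a + b) = F h a + F h b"
      "\<And>h x. h \<in> autohomeomorphisms (top_of_set {0..1}) \<Longrightarrow> x \<in> {0..1} \<Longrightarrow> F h (i x) = i (h x)"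
      "\<And>g h. g \<in> autohomeomorphisms (top_of_set {0..1}) \<Longrightarrow> h \<in> autohomeomorphisms (top_of_set {0..1}) \<Longrightarrow>
         F (compose {0..1} g h) = F g \<circ> F h"
    using assms by (simp_all add: functorial_embedding_def)
  interpret equivariant_arc "\<lambda>x. i (x / 2)" "\<lambda>h. F (?c h)"
  proof
    have "homeomorphic_map (top_of_set {0..1}) (top_of_set (i ` {0..1})) i"
      using emb by (simp add: embedding_map_def)
    then have "continuous_on {0..1} i"
      using homeomorphic_imp_continuous_map by fastforce
    then show "continuous_on {0..2} (\<lambda>x. i (x / 2))"
      by (rule continuous_on_compose2) (auto intro!: continuous_intros)
    show "\<not> insep (i (x / 2)) (i (y / 2))" if "x \<in> {0..2}" "y \<in> {0..2}" "x \<noteq> y" for x y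
      by (rule embedding_not_insep[OF emb]) (use that in auto)
  next
    fix h assume h: "incr_bij h" "fixes_off 0 2 h"
    note h' = autohomeomorphism_of_incr_bij[OF h]
    show "continuous_on UNIV (F (?c h))" by (rule Fh(1)[OF h'])
    show "F (?c h) (a + b) = F (?c h) a + F (?c h) b" for a b by (rule Fh(2)[OF h'])
    show "F (?c h) (i (t / 2)) = i (h t / 2)" if "t \<in> {0..2}" for t
      using Fh(3)[OF h', of "t / 2"] that by simp
  next
    fix g h a assume g: "incr_bij g" "fixes_off 0 2 g" and h: "incr_bij h" "fixes_off 0 2 h"
    \<comment> \<open>Outside \<open>{0..1}\<close> both sides are \<open>undefined\<close>, so they
      are equal as functions and \<open>F\<close> may be applied.\<close>
    have "?c (g \<circ> h) = compose {0..1} (?c g) (?c h)"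
    proof
      fix x
      show "?c (g \<circ> h) x = compose {0..1} (?c g) (?c h) x"
        using fixes_off_maps[OF h, of "2 * x"] by (cases "x \<in> {0..1}") (auto simp: compose_def)
    qed
    then show "F (?c (g \<circ> h)) a = F (?c g) (F (?c h) a)"
      using Fh(4)[OF autohomeomorphism_of_incr_bij[OF g] autohomeomorphism_of_incr_bij[OF h]] by simp
  qed
  show ?thesis by (rule sequential_hedgehog_exists)
qed

end
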